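(* Let $G$ be a group and let $Y \leqslant G$. The following hold: (i) $ab_1(G,Y) = Rep_1(G,Y)$; (ii) $ab_n(G,Y) \leq n \cdot Rep_n(G,Y)$ for every $n \geq 1$.
   Context: For a group $G$, a subgroup $Y \leqslant G$ and an integer $n\ge 1$: $ab_n(G,Y) := \sup\{\, |H/H'Y| : Y \leqslant H \leqslant G,\ |G:H| \leq n\,\}$, where $H'=[H,H]$ (note that $H'Y \lhd H$); $Rep_n(G,Y)$ is the number of pairwise inequivalent irreducible complex representations of $G$ that have a non-zero $Y$-fixed vector, degree at most $n$, and finite image.
   Formalization: False for G=(Q,+), Y=1, n=1 (ab_1 infinite, Rep_1=1); the formal statement adds, for the given n, that each infinite H/H'Y with Y ≤ H ≤ G, |G:H| ≤ n has finite quotients of arbitrarily large order; all infinite values count as one infinity. *)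

theory Defs
  imports
    "HOL-Library.Extended_Nat"
    "HOL-Algebra.Algebra"
    "Jordan_Normal_Form.VS_Connect"
begin

text \<open>Infinite cardinalities are not distinguished from each other.\<close>

definition ecard :: "'a set \<Rightarrow> enat" where
  "ecard A = (if finite A then enat (card A) else \<infinity>)"

definition intermediate_subgroups :: "('a, 'b) monoid_scheme \<Rightarrow> 'a set \<Rightarrow> nat \<Rightarrow> 'a set set" where
  "intermediate_subgroups G Y n =
     {H. subgroup H G \<and> Y \<subseteq> H \<and> ecard (rcosets\<^bsub>G\<^esub> H) \<le> enat n}"

definition rel_abelianization :: "('a, 'b) monoid_scheme \<Rightarrow> 'a set \<Rightarrow> 'a set \<Rightarrow> 'a set monoid" where
  "rel_abelianization G H Y = (G\<lparr>carrier := H\<rparr>) Mod (derived G H <#>\<^bsub>G\<^esub> Y)"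

definition ab :: "nat \<Rightarrow> ('a, 'b) monoid_scheme \<Rightarrow> 'a set \<Rightarrow> enat" where
  "ab n G Y = (SUP H \<in> intermediate_subgroups G Y n. ecard (carrier (rel_abelianization G H Y)))"

definition general_linear_group :: "nat \<Rightarrow> complex mat monoid" where
  "general_linear_group d = units_of (ring_mat TYPE(complex) d ())"

definition irreducible_rep ::
  "('a, 'b) monoid_scheme \<Rightarrow> nat \<Rightarrow> ('a \<Rightarrow> complex mat) \<Rightarrow> bool" where
  "irreducible_rep G d \<rho> \<longleftrightarrow>
     \<rho> \<in> hom G (general_linear_group d) \<and> 0 < d \<and>
     (\<forall>W. VectorSpace.subspace class_ring W (module_vec TYPE(complex) d) \<and>
          (\<forall>x\<in>carrier G. \<forall>w\<in>W. \<rho> x *\<^sub>v w \<in> W)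
        \<longrightarrow> W = {0\<^sub>v d} \<or> W = carrier_vec d)"

definition has_nonzero_fixed_vector :: "'a set \<Rightarrow> nat \<Rightarrow> ('a \<Rightarrow> complex mat) \<Rightarrow> bool" where
  "has_nonzero_fixed_vector Y d \<rho> \<longleftrightarrow>
     (\<exists>v\<in>carrier_vec d. v \<noteq> 0\<^sub>v d \<and> (\<forall>y\<in>Y. \<rho> y *\<^sub>v v = v))"

text \<open>A representation is stored together with its degree.\<close>

definition irreps ::
  "nat \<Rightarrow> ('a, 'b) monoid_scheme \<Rightarrow> 'a set \<Rightarrow> (nat \<times> ('a \<Rightarrow> complex mat)) set" where
  "irreps n G Y = {(d, \<rho>). irreducible_rep G d \<rho> \<and> d \<le> n \<and>
     has_nonzero_fixed_vector Y d \<rho> \<and> finite (\<rho> ` carrier G)}"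

text \<open>Only values on the carrier are compared, so functions differing outside
  \<open>carrier G\<close> represent the same class.\<close>

definition equivalent_reps ::
  "('a, 'b) monoid_scheme \<Rightarrow> ((nat \<times> ('a \<Rightarrow> complex mat)) \<times> (nat \<times> ('a \<Rightarrow> complex mat))) set" where
  "equivalent_reps G = {((d, \<rho>), (e, \<sigma>)). d = e \<and>
     (\<exists>P\<in>carrier (general_linear_group d). \<forall>x\<in>carrier G. P * \<rho> x = \<sigma> x * P)}"

definition Rep :: "nat \<Rightarrow> ('a, 'b) monoid_scheme \<Rightarrow> 'a set \<Rightarrow> enat" where
  "Rep n G Y = ecard (irreps n G Y // (equivalent_reps G \<inter> irreps n G Y \<times> irreps n G Y))"

text \<open>Representations with finite image only detect finite quotients, so an infinite abelian
  section must be visible in finite quotients. The following condition is vacuous when all the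
  groups \<open>H/H'Y\<close> are finite, and it holds when \<open>G\<close> is finitely generated. It cannot be
  dropped: see \<open>ab_ne_Rep_rat\<close> below.\<close>

definition infinite_sections_visible :: "nat \<Rightarrow> ('a, 'b) monoid_scheme \<Rightarrow> 'a set \<Rightarrow> bool" where
  "infinite_sections_visible n G Y \<longleftrightarrow>
     (\<forall>H \<in> intermediate_subgroups G Y n.
        infinite (carrier (rel_abelianization G H Y)) \<longrightarrow>
        (\<forall>m. \<exists>N. subgroup N (rel_abelianization G H Y) \<and>
           finite (rcosets\<^bsub>rel_abelianization G H Y\<^esub> N) \<and>
           m \<le> card (rcosets\<^bsub>rel_abelianization G H Y\<^esub> N)))"

definition rat_add_group :: "rat monoid" where
  "rat_add_group = \<lparr>carrier = UNIV, monoid.mult = (+), one = 0\<rparr>"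

lemma group_rat: "group rat_add_group"
  by (rule groupI) (auto simp: rat_add_group_def intro: exI[of _ "- x" for x])

lemma finite_image_rat_hom:
  fixes f :: "rat \<Rightarrow> complex"
  assumes add: "\<And>x y. f (x + y) = f x * f y" and zero: "f 0 = 1" and fin: "finite (range f)"
  shows "f x = 1"
proof -
  have pw: "f (of_nat m * y) = f y ^ m" for m y
    by (induction m) (auto simp: zero add algebra_simps)
  have nz: "f y \<noteq> 0" for y
    using add[of y "- y"] zero by auto
  have "\<exists>k>0. w ^ k = 1" if "w \<in> range f" for w
  proof -
    obtain y where y: "w = f y" using \<open>w \<in> range f\<close> by auto
    have "range (\<lambda>m. w ^ m) \<subseteq> range f"
      using pw[of _ y] y by (metis image_subsetI rangeI)
    hence "finite (range (\<lambda>m::nat. w ^ m))" using fin finite_subset by blast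
    hence "\<not> inj (\<lambda>m::nat. w ^ m)" using finite_imageD by auto
    then obtain i j :: nat where "w ^ i = w ^ j" "i < j"
      unfolding inj_def by (metis nat_neq_iff)
    moreover have "w ^ j = w ^ i * w ^ (j - i)"
      using \<open>i < j\<close> by (simp flip: power_add)
    ultimately have "w ^ (j - i) = 1" using nz[of y] y by simp
    thus ?thesis using \<open>i < j\<close> by (intro exI[of _ "j - i"]) simp
  qed
  then obtain k where k: "\<And>w. w \<in> range f \<Longrightarrow> k w > 0 \<and> w ^ k w = (1::complex)" by metis
  define N where "N = (\<Prod>w\<in>range f. k w)"
  have N: "N > 0" unfolding N_def using k fin by (intro prod_pos) auto
  define y where "y = x / of_nat N"
  have "k (f y) dvd N" unfolding N_def using fin by (intro dvd_prodI) auto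
  then obtain c where "N = k (f y) * c" by auto
  hence "f y ^ N = 1" using k[of "f y"] by (simp add: power_mult)
  moreover have "x = of_nat N * y" using N by (simp add: y_def)
  ultimately show ?thesis using pw[of N y] by simp
qed

lemma irreps_rat:
  assumes "(d, \<rho>) \<in> irreps 1 rat_add_group Y"
  shows "d = 1 \<and> \<rho> x = 1\<^sub>m 1"
proof -
  have d: "d = 1"
    using assms by (auto simp: irreps_def irreducible_rep_def)
  have hom: "\<rho> \<in> hom rat_add_group (general_linear_group 1)" and fin: "finite (range \<rho>)"
    using assms by (auto simp: d irreps_def irreducible_rep_def rat_add_group_def)
  have car: "\<rho> y \<in> carrier_mat 1 1" for y
    using hom by (auto simp: hom_def general_linear_group_def units_of_def Units_def ring_mat_def
        rat_add_group_def Pi_iff)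
  have mult: "\<rho> (y + z) = \<rho> y * \<rho> z" for y z
    using hom by (auto simp: hom_def general_linear_group_def units_of_def ring_mat_def rat_add_group_def)
  have inv: "\<exists>B. B \<in> carrier_mat 1 1 \<and> B * \<rho> 0 = 1\<^sub>m 1"
    using hom by (auto simp: hom_def general_linear_group_def units_of_def Units_def ring_mat_def
        rat_add_group_def Pi_iff)
  define f where "f = (\<lambda>y. \<rho> y $$ (0,0))"
  have f_add: "f (y + z) = f y * f z" for y z
    unfolding f_def mult using car[of y] car[of z] by (auto simp: scalar_prod_def)
  obtain B where B: "B \<in> carrier_mat 1 1" "B * \<rho> 0 = 1\<^sub>m 1" using inv by auto
  have "(B * \<rho> 0) $$ (0,0) = B $$ (0,0) * f 0"
    unfolding f_def using B(1) car[of 0] by (auto simp: scalar_prod_def)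
  hence "f 0 \<noteq> 0" using B(2) by auto
  hence f0: "f 0 = 1" using f_add[of 0 0] by simp
  have "range f = (\<lambda>A. A $$ (0,0)) ` range \<rho>" by (auto simp: f_def)
  hence "finite (range f)" using fin by simp
  hence "f x = 1" using finite_image_rat_hom[of f] f_add f0 by blast
  hence "\<rho> x = 1\<^sub>m 1" using car[of x] by (auto simp: f_def)
  thus ?thesis using d by simp
qed

lemma ab_ne_Rep_rat: "ab 1 rat_add_group {0} \<noteq> Rep 1 rat_add_group {0}"
proof -
  interpret G: group rat_add_group by (rule group_rat)
  have UNIV: "UNIV \<in> intermediate_subgroups rat_add_group {0} 1"
  proof -
    have "subgroup UNIV rat_add_group"
      using G.subgroup_self by (simp add: rat_add_group_def)
    moreover have "rcosets\<^bsub>rat_add_group\<^esub> UNIV = {UNIV}"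
      by (auto simp: RCOSETS_def r_coset_def rat_add_group_def intro: exI[of _ "x - y" for x y])
    ultimately show ?thesis by (auto simp: intermediate_subgroups_def ecard_def one_enat_def)
  qed
  have "derived_set rat_add_group UNIV \<subseteq> {0}"
  proof -
    have "inv\<^bsub>rat_add_group\<^esub> x = - x" for x
      by (rule G.inv_equality) (auto simp: rat_add_group_def)
    thus ?thesis by (auto simp: rat_add_group_def)
  qed
  hence "derived rat_add_group UNIV \<subseteq> {0}"
    unfolding derived_def
    using G.triv_subgroup by (intro G.generate_subgroup_incl) (simp_all add: rat_add_group_def)
  moreover have "0 \<in> derived rat_add_group UNIV"
    unfolding derived_def using generate.one[of rat_add_group] by (simp add: rat_add_group_def)
  ultimately have der: "derived rat_add_group UNIV = {0}" by auto
  have car: "carrier (rel_abelianization rat_add_group UNIV {0}) = range (\<lambda>x. {x})"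
    unfolding rel_abelianization_def der
    by (auto simp: FactGroup_def RCOSETS_def r_coset_def set_mult_def rat_add_group_def)
  have "infinite (range (\<lambda>x::rat. {x}))"
    using finite_imageD[of "\<lambda>x::rat. {x}" UNIV] by (auto simp: inj_def infinite_UNIV_char_0)
  hence "ecard (carrier (rel_abelianization rat_add_group UNIV {0})) = \<infinity>"
    by (simp add: car ecard_def)
  hence ab: "ab 1 rat_add_group {0} = \<infinity>"
    unfolding ab_def using UNIV by (metis SUP_upper enat_ord_simps(5))
  let ?I = "irreps 1 rat_add_group {0}"
  let ?E = "equivalent_reps rat_add_group \<inter> ?I \<times> ?I"
  have one: "1\<^sub>m 1 \<in> carrier (general_linear_group 1)"
    by (auto simp: general_linear_group_def units_of_def Units_def ring_mat_def intro!: bexI[of _ "1\<^sub>m 1"])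
  have "(a, b) \<in> ?E" if "a \<in> ?I" "b \<in> ?I" for a b
  proof -
    have "fst a = 1" "fst b = 1" "snd a x = 1\<^sub>m 1" "snd b x = 1\<^sub>m 1" for x
      using that irreps_rat[of "fst a" "snd a" "{0}"] irreps_rat[of "fst b" "snd b" "{0}"] by simp_all
    thus ?thesis
      using that one by (auto simp: equivalent_reps_def split_beta)
  qed
  hence "?I // ?E \<subseteq> {?I}" by (auto simp: quotient_def)
  hence "finite (?I // ?E)" using finite_subset by blast
  hence "Rep 1 rat_add_group {0} \<noteq> \<infinity>" by (simp add: Rep_def ecard_def)
  thus ?thesis using ab by metis
qed

end

theory Submission
  imports Defs "HOL-Library.Function_Algebras"
begin

text \<open>
  The idea is to compare linear characters of subgroups of index at most \<open>n\<close> with irreducible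
  representations of \<open>G\<close> of degree at most \<open>n\<close>, by induction in one direction and restriction in
  the other.

  Let \<open>Y \<subseteq> H\<close> with \<open>|G:H| \<le> n\<close> and let \<open>A = H/H'Y\<close>. A finite abelian group has as many linear
  characters as elements (\<open>card_linear_characters\<close>), so a finite quotient of \<open>A\<close> with \<open>m\<close> elements
  yields \<open>m\<close> characters of \<open>H\<close> that are trivial on \<open>Y\<close> and have finite image
  (\<open>characters_of_finite_abelian_quotient\<close>). The representation of \<open>G\<close> induced from such a
  character \<open>\<chi>\<close> has dimension \<open>|G:H| \<le> n\<close> and finite image, and is generated by an \<open>H\<close>-eigenvector
  of weight \<open>\<chi>\<close>. An irreducible quotient of it still contains a nonzero eigenvector of weight \<open>\<chi>\<close>
  (\<open>irreducible_quotient\<close>, \<open>irreducible_rep_with_character\<close>); this vector is fixed by \<open>Y\<close>.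
  Conversely, eigenvectors of distinct weights are linearly independent, so an irreducible
  representation of degree at most \<open>n\<close> contains at most \<open>n\<close> characters of \<open>H\<close>
  (\<open>card_weights_le_degree\<close>). Counting gives \<open>m \<le> n * Rep n G Y\<close> (\<open>card_characters_le_Rep\<close>). If \<open>A\<close>
  is finite, take \<open>m = |A|\<close>; if \<open>A\<close> is infinite, visibility of infinite sections lets \<open>m\<close> grow
  without bound.

  For \<open>n = 1\<close> this is one inequality of the first part. The other one holds because a representation
  of degree one with a nonzero \<open>Y\<close>-fixed vector is a linear character of \<open>G/G'Y\<close>
  (\<open>linear_character_of_degree_one_rep\<close>).
\<close>

section \<open>Simultaneous eigenvectors\<close>

text \<open>The classical proof that eigenvectors to distinct eigenvalues are independent, for a family of
  operators in place of a single one. A weight is the function \<open>\<chi>\<close> that sends the index of an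
  operator to the eigenvalue. From a relation involving \<open>v \<psi>\<close>, applying \<open>T a\<close> and subtracting
  \<open>\<psi> a\<close> times the relation removes \<open>v \<psi>\<close> and multiplies each other coefficient by
  \<open>\<chi> a - \<psi> a\<close>, which is nonzero for a suitable \<open>a\<close>.\<close>
lemma (in vector_space) weight_vectors_sum_zero:
  assumes lin: "\<And>a. a \<in> A \<Longrightarrow> Vector_Spaces.linear scale scale (T a)"
    and weight: "\<And>\<chi> a. \<chi> \<in> Z \<Longrightarrow> a \<in> A \<Longrightarrow> T a (v \<chi>) = \<chi> a *s v \<chi>"
    and nonzero: "\<And>\<chi>. \<chi> \<in> Z \<Longrightarrow> v \<chi> \<noteq> 0"
    and distinct: "\<And>\<chi> \<psi>. \<chi> \<in> Z \<Longrightarrow> \<psi> \<in> Z \<Longrightarrow> (\<And>a. a \<in> A \<Longrightarrow> \<chi> a = \<psi> a) \<Longrightarrow> \<chi> = \<psi>"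
    and "finite Z" "(\<Sum>\<chi>\<in>Z. c \<chi> *s v \<chi>) = 0" "\<chi> \<in> Z"
  shows "c \<chi> = 0"
  using \<open>finite Z\<close> weight nonzero distinct assms(6,7)
proof (induction Z arbitrary: c \<chi> rule: finite_induct)
  case empty
  then show ?case by simp
next
  case (insert \<psi> Z)
  have sum0: "c \<psi> *s v \<psi> + (\<Sum>\<chi>\<in>Z. c \<chi> *s v \<chi>) = 0"
    using insert.prems(4) insert.hyps by simp
  have smaller: "c \<chi> = 0" if "\<chi> \<in> Z" for \<chi>
  proof -
    have "\<chi> \<noteq> \<psi>" using that insert.hyps by auto
    hence "\<not> (\<forall>a\<in>A. \<chi> a = \<psi> a)"
      using insert.prems(3)[OF insertI2[OF that] insertI1] by auto
    then obtain a where a: "a \<in> A" "\<chi> a \<noteq> \<psi> a" by auto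
    interpret T: Vector_Spaces.linear scale scale "T a" by (rule lin[OF a(1)])
    have "T a (c \<psi> *s v \<psi> + (\<Sum>\<chi>\<in>Z. c \<chi> *s v \<chi>)) = 0"
      unfolding sum0 by (rule T.zero)
    moreover have "T a (c \<psi> *s v \<psi> + (\<Sum>\<chi>\<in>Z. c \<chi> *s v \<chi>)) =
        (c \<psi> * \<psi> a) *s v \<psi> + (\<Sum>\<chi>\<in>Z. (c \<chi> * \<chi> a) *s v \<chi>)"
      using insert.prems(1)[OF _ a(1)]
      by (simp add: T.add T.sum T.scale)
    ultimately have "(c \<psi> * \<psi> a) *s v \<psi> + (\<Sum>\<chi>\<in>Z. (c \<chi> * \<chi> a) *s v \<chi>) = 0" by simp
    moreover have "\<psi> a *s (c \<psi> *s v \<psi> + (\<Sum>\<chi>\<in>Z. c \<chi> *s v \<chi>)) = 0" using sum0 by simp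
    ultimately have "((c \<psi> * \<psi> a) *s v \<psi> + (\<Sum>\<chi>\<in>Z. (c \<chi> * \<chi> a) *s v \<chi>))
        - \<psi> a *s (c \<psi> *s v \<psi> + (\<Sum>\<chi>\<in>Z. c \<chi> *s v \<chi>)) = 0" by simp
    also have "((c \<psi> * \<psi> a) *s v \<psi> + (\<Sum>\<chi>\<in>Z. (c \<chi> * \<chi> a) *s v \<chi>))
        - \<psi> a *s (c \<psi> *s v \<psi> + (\<Sum>\<chi>\<in>Z. c \<chi> *s v \<chi>)) =
        (\<Sum>\<chi>\<in>Z. (c \<chi> * (\<chi> a - \<psi> a)) *s v \<chi>)"
      by (simp add: scale_right_distrib scale_sum_right sum_subtractf[symmetric]
          scale_left_diff_distrib right_diff_distrib mult.commute)
    finally have "(\<Sum>\<chi>\<in>Z. (c \<chi> * (\<chi> a - \<psi> a)) *s v \<chi>) = 0" .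
    hence "c \<chi> * (\<chi> a - \<psi> a) = 0"
      using insert.IH[where c = "\<lambda>\<chi>. c \<chi> * (\<chi> a - \<psi> a)" and \<chi> = \<chi>] insert.prems(1-3) that by simp
    thus ?thesis using a by simp
  qed
  moreover have "c \<psi> = 0" using sum0 smaller insert.prems(2)[of \<psi>] by simp
  ultimately show ?case using insert.prems(5) by auto
qed

text \<open>Used twice: a finite abelian group of order \<open>m\<close> has at most \<open>m\<close> linear characters, and a
  representation of degree \<open>d\<close> contains at most \<open>d\<close> linear characters of a subgroup.\<close>
lemma (in vector_space) card_weights_le:
  assumes lin: "\<And>a. a \<in> A \<Longrightarrow> Vector_Spaces.linear scale scale (T a)"
    and weight: "\<And>\<chi> a. \<chi> \<in> Z \<Longrightarrow> a \<in> A \<Longrightarrow> T a (v \<chi>) = \<chi> a *s v \<chi>"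
    and nonzero: "\<And>\<chi>. \<chi> \<in> Z \<Longrightarrow> v \<chi> \<noteq> 0"
    and distinct: "\<And>\<chi> \<psi>. \<chi> \<in> Z \<Longrightarrow> \<psi> \<in> Z \<Longrightarrow> (\<And>a. a \<in> A \<Longrightarrow> \<chi> a = \<psi> a) \<Longrightarrow> \<chi> = \<psi>"
    and "finite B" "v ` Z \<subseteq> span B"
  shows "finite Z \<and> card Z \<le> card B"
proof -
  have inj: "inj_on v Z"
  proof (rule inj_onI)
    fix \<chi> \<psi> assume *: "\<chi> \<in> Z" "\<psi> \<in> Z" "v \<chi> = v \<psi>"
    have "\<chi> a = \<psi> a" if "a \<in> A" for a
      using weight[OF *(1) that] weight[OF *(2) that] nonzero[OF *(1)] *(3) by simp
    thus "\<chi> = \<psi>" using distinct * by blast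
  qed
  have "independent (v ` Z)"
    unfolding independent_explicit_finite_subsets
  proof (intro allI impI ballI)
    fix S u w assume S: "S \<subseteq> v ` Z" "finite S" and sum0: "(\<Sum>w\<in>S. u w *s w) = 0" and "w \<in> S"
    then obtain W where W: "W \<subseteq> Z" "finite W" "S = v ` W"
      by (meson finite_subset_image)
    obtain \<chi> where "\<chi> \<in> W" "w = v \<chi>" using \<open>w \<in> S\<close> W by auto
    moreover have "(\<Sum>\<chi>\<in>W. u (v \<chi>) *s v \<chi>) = 0"
      using sum0 inj W by (simp add: sum.reindex inj_on_subset)
    ultimately show "u w = 0"
      using weight_vectors_sum_zero[of A T W v "\<lambda>\<chi>. u (v \<chi>)" \<chi>] lin weight nonzero distinct W by blast
  qed
  hence "finite (v ` Z) \<and> card (v ` Z) \<le> card B"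
    using independent_span_bound assms(5,6) by blast
  thus ?thesis using inj by (simp add: card_image finite_image_iff)
qed

section \<open>Irreducible quotients of cyclic representations\<close>

text \<open>A representation \<open>T\<close> of \<open>G\<close> generated by one vector \<open>\<delta>\<close> with finitely many translates. The
  module is the span of these translates; outside it nothing but linearity and multiplicativity
  of \<open>T\<close> is asked for, so that \<open>T\<close> can be given by a formula on a whole function space.\<close>
locale cyclic_action = vector_space scale + G: group G
  for scale :: "complex \<Rightarrow> 'v::ab_group_add \<Rightarrow> 'v" (infixr \<open>*s\<close> 75)
    and G :: "('a, 'b) monoid_scheme" (structure) +
  fixes T :: "'a \<Rightarrow> 'v \<Rightarrow> 'v" and \<delta> :: 'v
  assumes linear_T: "x \<in> carrier G \<Longrightarrow> Vector_Spaces.linear scale scale (T x)"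
    and T_mult: "\<lbrakk>x \<in> carrier G; y \<in> carrier G\<rbrakk> \<Longrightarrow> T (x \<otimes> y) v = T x (T y v)"
    and T_one: "T \<one> \<delta> = \<delta>"
    and \<delta>_nonzero: "\<delta> \<noteq> 0"
    and finite_orbit: "finite ((\<lambda>x. T x \<delta>) ` carrier G)"
begin

abbreviation "translates \<equiv> (\<lambda>x. T x \<delta>) ` carrier G"

abbreviation "invariant M \<equiv> (\<forall>x\<in>carrier G. \<forall>v\<in>M. T x v \<in> M)"

lemma \<delta>_in_translates: "\<delta> \<in> translates"
  using T_one by (force intro: image_eqI[of _ _ \<one>])

lemma T_translates: "x \<in> carrier G \<Longrightarrow> v \<in> translates \<Longrightarrow> T x v \<in> translates"
  by (auto simp: T_mult[symmetric])

lemma T_span: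
  assumes "x \<in> carrier G" "\<And>v. v \<in> S \<Longrightarrow> T x v \<in> span S'" "v \<in> span S"
  shows "T x v \<in> span S'"
proof -
  interpret T: Vector_Spaces.linear scale scale "T x" by (rule linear_T) fact
  show ?thesis using assms(3)
  proof (induction rule: span_induct_alt)
    case base
    show ?case by (simp add: T.zero span_zero)
  next
    case (step c u w)
    thus ?case using assms(2)[of u] by (simp add: T.add T.scale span_add span_scale)
  qed
qed

lemma invariant_span_translates: "invariant (span translates)"
proof (intro ballI)
  fix x v assume "x \<in> carrier G" "v \<in> span translates"
  show "T x v \<in> span translates"
  proof (rule T_span)
    show "T x w \<in> span translates" if "w \<in> translates" for w
      by (rule span_base) (rule T_translates[OF \<open>x \<in> carrier G\<close> that])
  qed fact+
qed

lemma invariant_containing_\<delta>: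
  assumes "subspace M" "invariant M" "\<delta> \<in> M"
  shows "span translates \<subseteq> M"
proof (rule span_minimal)
  show "translates \<subseteq> M" using assms(2,3) by auto
qed fact

text \<open>Coordinates on an irreducible quotient. An invariant subspace of a cyclic module is proper iff
  it misses the generator \<open>\<delta>\<close>; let \<open>K\<close> be a maximal one. The functionals \<open>r i\<close>, \<open>i < e\<close>, are
  coordinates on the quotient by \<open>K\<close>, and the vectors \<open>b i\<close> lift the dual basis. A quotient
  is taken in place of a submodule because the image of \<open>\<delta>\<close> in a nonzero quotient cannot vanish.\<close>
lemma quotient_coordinates:
  assumes B0: "finite B0" "translates \<subseteq> span B0"
  obtains e :: nat and r :: "nat \<Rightarrow> 'v \<Rightarrow> complex" and b :: "nat \<Rightarrow> 'v" and K
  where "0 < e" "e \<le> card B0"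
    and "\<And>i. Vector_Spaces.linear scale (*) (r i)"
    and "\<And>i. i < e \<Longrightarrow> b i \<in> span translates"
    and "\<And>i j. i < e \<Longrightarrow> j < e \<Longrightarrow> r i (b j) = (if i = j then 1 else 0)"
    and "\<And>v. v \<in> K \<longleftrightarrow> v \<in> span translates \<and> (\<forall>i<e. r i v = 0)"
    and "subspace K" "invariant K" "\<delta> \<notin> K"
    and "\<And>M. subspace M \<Longrightarrow> invariant M \<Longrightarrow> K \<subseteq> M \<Longrightarrow> M \<subseteq> span translates \<Longrightarrow> \<delta> \<notin> M \<Longrightarrow> M \<subseteq> K"
proof -
  \<comment> \<open>The subspace is described by a basis \<open>S\<close>, so that maximality becomes maximality of
    \<open>card S\<close>, which is bounded by \<open>card B0\<close>.\<close>
  define good where "good S \<longleftrightarrow> independent S \<and> S \<subseteq> span translates \<and> invariant (span S) \<and> \<delta> \<notin> span S" for S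
  have B0V: "span translates \<subseteq> span B0" using B0(2) span_minimal subspace_span by blast
  have bound: "finite S \<and> card S \<le> card B0" if "independent S" "S \<subseteq> span translates" for S
    using independent_span_bound[OF B0(1) that(1)] that(2) B0V by auto
  have "T x 0 = 0" if "x \<in> carrier G" for x
  proof -
    interpret T: Vector_Spaces.linear scale scale "T x" by (rule linear_T) fact
    show ?thesis by (rule T.zero)
  qed
  hence "good {}"
    using \<delta>_nonzero by (simp add: good_def independent_empty)
  moreover have "\<forall>S. good S \<longrightarrow> card S < Suc (card B0)"
    using bound by (simp add: good_def less_Suc_eq_le)
  ultimately have "\<exists>S. good S \<and> (\<forall>S'. good S' \<longrightarrow> card S' \<le> card S)"
    by (rule ex_has_greatest_nat)
  then obtain S where "good S" and greatest: "\<And>S'. good S' \<Longrightarrow> card S' \<le> card S"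
    by auto
  hence S: "independent S" "S \<subseteq> span translates" "invariant (span S)" "\<delta> \<notin> span S"
    by (auto simp: good_def)
  obtain B where B: "S \<subseteq> B" "B \<subseteq> span translates" "independent B" "span translates \<subseteq> span B"
    using maximal_independent_subset_extend[OF S(2,1)] by metis
  have finB: "finite B" "card B \<le> card B0" using bound B by auto
  \<comment> \<open>The vectors in \<open>B - S\<close> represent a basis of the quotient, so \<open>e\<close> is its dimension.\<close>
  define e where "e = card (B - S)"
  obtain b where b: "bij_betw b {..<e} (B - S)"
    unfolding e_def using finB ex_bij_betw_nat_finite[of "B - S"] by (auto simp: atLeast0LessThan)
  interpret W: vector_space "(*) :: complex \<Rightarrow> complex \<Rightarrow> complex"
    by unfold_locales (auto simp: algebra_simps)
  interpret VW: vector_space_pair scale "(*) :: complex \<Rightarrow> complex \<Rightarrow> complex" ..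
  have "\<exists>g. Vector_Spaces.linear scale (*) g \<and> (\<forall>x\<in>B. g x = (if x = b i then 1 else 0))" for i
    by (rule VW.linear_independent_extend) fact
  then obtain r where lin_r: "\<And>i. Vector_Spaces.linear scale (*) (r i)"
    and r: "\<And>i x. x \<in> B \<Longrightarrow> r i x = (if x = b i then 1 else 0)" by metis
  have bB: "b i \<in> B - S" if "i < e" for i using b that by (auto simp: bij_betw_def)
  have r_S: "r i v = 0" if "i < e" "v \<in> span S" for i v
  proof -
    interpret r: Vector_Spaces.linear scale "(*)" "r i" by (rule lin_r)
    show ?thesis using that(2)
    proof (induction rule: span_induct_alt)
      case (step c x y)
      have "x \<in> B" "x \<noteq> b i" using step.hyps(1) B(1) bB[OF that(1)] by auto
      hence "r i x = 0" using r by simp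
      thus ?case using step.IH by (simp add: r.add r.scale)
    qed (rule r.zero)
  qed
  have K: "v \<in> span S \<longleftrightarrow> v \<in> span translates \<and> (\<forall>i<e. r i v = 0)" for v
  proof safe
    assume "v \<in> span S" thus "v \<in> span translates" using span_minimal[OF S(2) subspace_span] by auto
  next
    assume v: "v \<in> span translates" "\<forall>i<e. r i v = 0"
    then obtain u where u: "v = (\<Sum>w\<in>B. u w *s w)"
      using B(4) finB span_finite by auto
    have "u w = 0" if w: "w \<in> B - S" for w
    proof -
      obtain i where i: "i < e" "w = b i" using w b by (auto simp: bij_betw_def)
      interpret r: Vector_Spaces.linear scale "(*)" "r i" by (rule lin_r)
      have "0 = r i v" using v i by simp
      also have "\<dots> = (\<Sum>w\<in>B. u w * r i w)" by (simp add: u r.sum r.scale)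
      also have "\<dots> = (\<Sum>w'\<in>B. if w' = w then u w' else 0)"
        by (rule sum.cong) (auto simp: r i)
      also have "\<dots> = u w" using w finB by simp
      finally show ?thesis by simp
    qed
    hence "v = (\<Sum>w\<in>S. u w *s w)"
      unfolding u using B(1) finB by (intro sum.mono_neutral_right) auto
    moreover have "(\<Sum>w\<in>S. u w *s w) \<in> span S"
      by (intro span_sum span_scale span_base)
    ultimately show "v \<in> span S" by simp
  qed (use r_S in auto)
  have e_pos: "0 < e"
  proof (rule ccontr)
    assume "\<not> 0 < e"
    hence "B - S = {}" using finB by (simp add: e_def)
    hence "B = S" using B by auto
    moreover have "\<delta> \<in> span translates" by (rule span_base[OF \<delta>_in_translates])
    ultimately show False using S(4) B(4) by auto
  qed
  have e_le: "e \<le> card B0" unfolding e_def using finB card_Diff_subset_Int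
    by (meson card_mono Diff_subset le_trans)
  have r_b: "r i (b j) = (if i = j then 1 else 0)" if "i < e" "j < e" for i j
    using r[of "b j" i] bB[OF that(2)] b that by (auto simp: bij_betw_def inj_on_def)
  \<comment> \<open>A larger invariant subspace missing \<open>\<delta>\<close> would have a basis properly containing \<open>S\<close>.\<close>
  have maximal: "M \<subseteq> span S" if M: "subspace M" "invariant M" "span S \<subseteq> M" "M \<subseteq> span translates" "\<delta> \<notin> M" for M
  proof -
    obtain S' where S': "S \<subseteq> S'" "S' \<subseteq> M" "independent S'" "M \<subseteq> span S'"
      using maximal_independent_subset_extend[of S M] S(1) M(3) span_superset by (metis order_trans)
    have "span S' = M" using S'(2,4) M(1) span_minimal by (metis subset_antisym)
    hence "good S'" unfolding good_def using S'(2,3) M(2,4,5) by auto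
    hence "card S' \<le> card S" by (rule greatest)
    moreover have "finite S'" using bound[of S'] S'(2,3) M(4) by simp
    ultimately have "S' = S" using S'(1) by (metis card_seteq)
    thus ?thesis using S' by simp
  qed
  have b_V: "b i \<in> span translates" if "i < e" for i using bB[OF that] B(2) by auto
  show ?thesis
    by (rule that[OF e_pos e_le lin_r b_V r_b K subspace_span S(3,4) maximal])
qed

lemma T_one_span:
  assumes "v \<in> span translates"
  shows "T \<one> v = v"
proof -
  interpret T: Vector_Spaces.linear scale scale "T \<one>" by (rule linear_T) simp
  show ?thesis using assms
  proof (induction rule: span_induct_alt)
    case (step c u w)
    then obtain x where "x \<in> carrier G" "u = T x \<delta>" by auto
    hence "T \<one> u = u" using T_mult[of \<one> x \<delta>] by simp
    thus ?case using step.IH by (simp add: T.add T.scale)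
  qed (rule T.zero)
qed

lemma T_eq_on_span:
  assumes "x \<in> carrier G" "y \<in> carrier G" "\<And>u. u \<in> translates \<Longrightarrow> T x u = T y u"
    and "v \<in> span translates"
  shows "T x v = T y v"
proof -
  interpret T: Vector_Spaces.linear scale scale "T x" by (rule linear_T) fact
  interpret T': Vector_Spaces.linear scale scale "T y" by (rule linear_T) fact
  show ?thesis using assms(4)
  proof (induction rule: span_induct_alt)
    case (step c u w)
    have "T x u = T y u" by (rule assms(3)) fact
    thus ?case using step.IH by (simp add: T.add T.scale T'.add T'.scale)
  qed (simp add: T.zero T'.zero)
qed

text \<open>Every cyclic module has an irreducible quotient, here written with matrices, in which the image
  \<open>w\<close> of the generator is nonzero. A line spanned by \<open>\<delta>\<close> and stable under \<open>x\<close> maps to a line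
  stable under \<open>x\<close> with the same eigenvalue. The image is finite because each \<open>T x\<close> is determined
  by the permutation that it induces on the finitely many translates of \<open>\<delta>\<close>.\<close>
lemma irreducible_quotient:
  assumes B0: "finite B0" "translates \<subseteq> span B0"
  obtains e \<rho> w where "irreducible_rep G e \<rho>" "e \<le> card B0" "finite (\<rho> ` carrier G)"
    and "w \<in> carrier_vec e" "w \<noteq> 0\<^sub>v e"
    and "\<And>x c. x \<in> carrier G \<Longrightarrow> T x \<delta> = c *s \<delta> \<Longrightarrow> \<rho> x *\<^sub>v w = c \<cdot>\<^sub>v w"
proof -
  obtain e :: nat and r :: "nat \<Rightarrow> 'v \<Rightarrow> complex" and b :: "nat \<Rightarrow> 'v" and K where
    e: "0 < e" "e \<le> card B0"
    and lin_r: "\<And>i. Vector_Spaces.linear scale (*) (r i)"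
    and b_V: "\<And>i. i < e \<Longrightarrow> b i \<in> span translates"
    and r_b: "\<And>i j. i < e \<Longrightarrow> j < e \<Longrightarrow> r i (b j) = (if i = j then 1 else 0)"
    and K: "\<And>v. v \<in> K \<longleftrightarrow> v \<in> span translates \<and> (\<forall>i<e. r i v = 0)"
    and K_sub: "subspace K" "invariant K" "\<delta> \<notin> K"
    and K_max: "\<And>M. subspace M \<Longrightarrow> invariant M \<Longrightarrow> K \<subseteq> M \<Longrightarrow> M \<subseteq> span translates \<Longrightarrow> \<delta> \<notin> M \<Longrightarrow> M \<subseteq> K"
    by (rule quotient_coordinates[OF B0]) (rule that)
  note V_inv = invariant_span_translates[rule_format]
  have \<delta>_V: "\<delta> \<in> span translates" by (rule span_base[OF \<delta>_in_translates])
  \<comment> \<open>\<open>q\<close> is the projection onto the quotient in coordinates, and \<open>lift\<close> is a section of it.\<close>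
  define q where "q v = vec e (\<lambda>i. r i v)" for v
  define lift where "lift w = (\<Sum>j<e. (w $ j) *s b j)" for w :: "complex vec"
  define \<rho> where "\<rho> x = mat e e (\<lambda>(i,j). r i (T x (b j)))" for x
  have \<rho>_car: "\<rho> x \<in> carrier_mat e e" for x by (simp add: \<rho>_def)
  have q_car: "q v \<in> carrier_vec e" for v by (simp add: q_def)
  have q_add: "q (u + v) = q u + q v" for u v
  proof (rule eq_vecI)
    fix i assume "i < dim_vec (q u + q v)"
    interpret r: Vector_Spaces.linear scale "(*)" "r i" by (rule lin_r)
    show "q (u + v) $ i = (q u + q v) $ i"
      using \<open>i < _\<close> by (simp add: q_def r.add)
  qed (simp add: q_def)
  have q_scale: "q (c *s v) = c \<cdot>\<^sub>v q v" for c v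
  proof (rule eq_vecI)
    fix i assume "i < dim_vec (c \<cdot>\<^sub>v q v)"
    interpret r: Vector_Spaces.linear scale "(*)" "r i" by (rule lin_r)
    show "q (c *s v) $ i = (c \<cdot>\<^sub>v q v) $ i"
      using \<open>i < _\<close> by (simp add: q_def r.scale)
  qed (simp add: q_def)
  have lift_V: "lift w \<in> span translates" for w
    unfolding lift_def by (intro span_sum span_scale b_V) simp
  have r_lift: "r i (lift w) = w $ i" if "i < e" for i w
  proof -
    interpret r: Vector_Spaces.linear scale "(*)" "r i" by (rule lin_r)
    have "r i (lift w) = (\<Sum>j<e. w $ j * r i (b j))" by (simp add: lift_def r.sum r.scale)
    also have "\<dots> = (\<Sum>j<e. if j = i then w $ j else 0)" using that by (intro sum.cong) (auto simp: r_b)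
    also have "\<dots> = w $ i" using that by simp
    finally show ?thesis .
  qed
  have q_lift: "q (lift w) = w" if "w \<in> carrier_vec e" for w
    using that by (intro eq_vecI) (auto simp: q_def r_lift)
  have q_K: "q v = 0\<^sub>v e \<longleftrightarrow> v \<in> K" if "v \<in> span translates" for v
    using that by (auto simp: K q_def vec_eq_iff)
  \<comment> \<open>\<open>v\<close> and \<open>lift (q v)\<close> differ by an element \<open>m\<close> of the invariant subspace \<open>K\<close>.\<close>
  have coord: "r i (T x v) = (\<Sum>j<e. r i (T x (b j)) * r j v)"
    if x: "x \<in> carrier G" and v: "v \<in> span translates" and i: "i < e" for x v i
  proof -
    interpret r: Vector_Spaces.linear scale "(*)" "r i" by (rule lin_r)
    interpret T: Vector_Spaces.linear scale scale "T x" by (rule linear_T) fact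
    define m where "m = v - lift (q v)"
    have "m \<in> span translates" unfolding m_def using v lift_V by (rule span_diff)
    moreover have "r k m = 0" if "k < e" for k
    proof -
      interpret rk: Vector_Spaces.linear scale "(*)" "r k" by (rule lin_r)
      show ?thesis using that by (simp add: m_def rk.diff r_lift q_def)
    qed
    ultimately have "m \<in> K" by (simp add: K)
    hence "T x m \<in> K" using K_sub(2) x by blast
    hence "r i (T x m) = 0" using K i by blast
    moreover have "T x v = T x m + T x (lift (q v))" by (simp add: m_def flip: T.add)
    ultimately have "r i (T x v) = r i (T x (lift (q v)))" by (simp add: r.add)
    also have "\<dots> = (\<Sum>j<e. r j v * r i (T x (b j)))"
      by (simp add: lift_def T.sum T.scale r.sum r.scale q_def)
    finally show ?thesis by (simp add: mult.commute)
  qed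
  have equivariant: "q (T x v) = \<rho> x *\<^sub>v q v" if "x \<in> carrier G" "v \<in> span translates" for x v
    using coord[OF that]
    by (intro eq_vecI) (auto simp: q_def \<rho>_def scalar_prod_def atLeast0LessThan)
  have \<rho>_mult: "\<rho> (x \<otimes> y) = \<rho> x * \<rho> y" if "x \<in> carrier G" "y \<in> carrier G" for x y
    using that coord[OF _ V_inv[OF _ b_V]]
    by (intro eq_matI) (auto simp: \<rho>_def scalar_prod_def atLeast0LessThan T_mult)
  have \<rho>_one: "\<rho> \<one> = 1\<^sub>m e"
    by (intro eq_matI) (auto simp: \<rho>_def T_one_span[OF b_V] r_b)
  have \<rho>_hom: "\<rho> \<in> hom G (general_linear_group e)"
  proof (rule homI)
    fix x assume x: "x \<in> carrier G"
    have "\<rho> (inv x) * \<rho> x = 1\<^sub>m e" "\<rho> x * \<rho> (inv x) = 1\<^sub>m e"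
      using x by (simp_all add: \<rho>_one flip: \<rho>_mult)
    thus "\<rho> x \<in> carrier (general_linear_group e)"
      using \<rho>_car by (auto simp: general_linear_group_def units_of_def Units_def ring_mat_def)
  next
    fix x y assume "x \<in> carrier G" "y \<in> carrier G"
    thus "\<rho> (x \<otimes> y) = \<rho> x \<otimes>\<^bsub>general_linear_group e\<^esub> \<rho> y"
      by (simp add: \<rho>_mult general_linear_group_def units_of_def ring_mat_def)
  qed
  have irred: "W = {0\<^sub>v e} \<or> W = carrier_vec e"
    if "VectorSpace.subspace class_ring W (module_vec TYPE(complex) e)"
      and W_inv: "\<forall>x\<in>carrier G. \<forall>w\<in>W. \<rho> x *\<^sub>v w \<in> W" for W
  proof -
    have "submodule class_ring W (module_vec TYPE(complex) e)"
      using that(1) by (simp add: VectorSpace.subspace_def)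
    hence W: "W \<subseteq> carrier_vec e" "0\<^sub>v e \<in> W" "\<And>u w. u \<in> W \<Longrightarrow> w \<in> W \<Longrightarrow> u + w \<in> W"
        "\<And>c w. w \<in> W \<Longrightarrow> c \<cdot>\<^sub>v w \<in> W"
      unfolding submodule_def by (auto simp: module_vec_simps)
    \<comment> \<open>The preimage of \<open>W\<close> contains \<open>K\<close>, so it is the whole module or \<open>K\<close> itself.\<close>
    define M where "M = {v \<in> span translates. q v \<in> W}"
    have "q 0 = 0\<^sub>v e" using q_K[of 0] span_zero subspace_0[OF K_sub(1)] by blast
    hence "subspace M"
      unfolding subspace_def M_def using W by (auto simp: q_add q_scale span_zero span_add span_scale)
    moreover have "invariant M"
      using W_inv V_inv by (auto simp: M_def equivariant)
    moreover have "K \<subseteq> M"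
    proof
      fix v assume "v \<in> K"
      hence "v \<in> span translates" "q v = 0\<^sub>v e" using K q_K by blast+
      thus "v \<in> M" using W(2) by (simp add: M_def)
    qed
    moreover have "M \<subseteq> span translates" by (auto simp: M_def)
    ultimately consider "span translates \<subseteq> M" | "M \<subseteq> K"
      using invariant_containing_\<delta>[of M] K_max[of M] by argo
    thus ?thesis
    proof cases
      case 1
      have "w \<in> W" if "w \<in> carrier_vec e" for w
        using 1 lift_V[of w] q_lift[OF that] by (auto simp: M_def)
      thus ?thesis using W(1) by auto
    next
      case 2
      have "w = 0\<^sub>v e" if "w \<in> W" for w
      proof -
        have "q (lift w) = w" using q_lift that W(1) by blast
        hence "lift w \<in> K" using 2 that lift_V by (auto simp: M_def)
        thus ?thesis using q_K[OF lift_V[of w]] \<open>q (lift w) = w\<close> by simp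
      qed
      thus ?thesis using W(2) by blast
    qed
  qed
  have fin: "finite (\<rho> ` carrier G)"
  proof -
    let ?perm = "\<lambda>x. restrict (T x) translates"
    have "?perm ` carrier G \<subseteq> translates \<rightarrow>\<^sub>E translates"
      using T_translates by auto
    hence fin: "finite (?perm ` carrier G)"
      using finite_orbit by (meson finite_PiE finite_subset)
    have "\<rho> x = \<rho> y" if "x \<in> carrier G" "y \<in> carrier G" "?perm x = ?perm y" for x y
    proof -
      have "T x u = T y u" if "u \<in> translates" for u
        using fun_cong[OF \<open>?perm x = ?perm y\<close>, of u] that by (simp only: restrict_apply if_True)
      hence "T x (b j) = T y (b j)" if "j < e" for j
        using T_eq_on_span[OF \<open>x \<in> _\<close> \<open>y \<in> _\<close>] b_V[OF that] by blast
      thus ?thesis by (intro eq_matI) (auto simp: \<rho>_def)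
    qed
    then obtain F where "\<And>x. x \<in> carrier G \<Longrightarrow> \<rho> x = F (?perm x)"
      using function_factors_left_gen[of "\<lambda>x. x \<in> carrier G" ?perm \<rho>] by metis
    hence "\<rho> ` carrier G = F ` ?perm ` carrier G" by (auto simp: image_image)
    thus ?thesis using fin by simp
  qed
  show ?thesis
  proof (rule that)
    show "irreducible_rep G e \<rho>"
      unfolding irreducible_rep_def using \<rho>_hom e(1) irred by blast
    show "q \<delta> \<noteq> 0\<^sub>v e" using q_K[OF \<delta>_V] K_sub(3) by simp
    show "\<rho> x *\<^sub>v q \<delta> = c \<cdot>\<^sub>v q \<delta>" if "x \<in> carrier G" "T x \<delta> = c *s \<delta>" for x c
      using equivariant[OF that(1) \<delta>_V] that(2) by (simp add: q_scale)
  qed (fact fin e q_car)+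
qed

end

section \<open>Vector spaces of complex-valued functions\<close>

interpretation function_space: vector_space "\<lambda>c (f :: 'x \<Rightarrow> complex) x. c * f x"
  by unfold_locales (auto simp: fun_eq_iff algebra_simps)

lemma sum_fun_apply: "(\<Sum>i\<in>I. f i) x = (\<Sum>i\<in>I. f i x)"
  by (induction I rule: infinite_finite_induct) auto

lemma linear_function_space_iff:
  "Vector_Spaces.linear (\<lambda>c (f :: 'x \<Rightarrow> complex) x. c * f x) (\<lambda>c (f :: 'y \<Rightarrow> complex) x. c * f x) T \<longleftrightarrow>
     (\<forall>f g. T (f + g) = T f + T g) \<and> (\<forall>c f. T (\<lambda>x. c * f x) = (\<lambda>x. c * T f x))"
  by (simp add: Vector_Spaces.linear_iff function_space.vector_space_axioms)

definition indicators :: "'x set \<Rightarrow> ('x \<Rightarrow> complex) set" where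
  "indicators C = (\<lambda>a x. if x = a then 1 else 0) ` C"

lemma in_span_indicators:
  assumes "finite C" "\<And>x. x \<notin> C \<Longrightarrow> f x = 0"
  shows "f \<in> function_space.span (indicators C)"
proof -
  have "f = (\<Sum>a\<in>C. (\<lambda>x. f a * (if x = a then 1 else 0)))"
    using assms by (auto simp: fun_eq_iff sum_fun_apply if_distrib[of "(*) _"] cong: if_cong)
  also have "\<dots> \<in> function_space.span (indicators C)"
    by (intro function_space.span_sum function_space.span_scale function_space.span_base)
       (simp add: indicators_def)
  finally show ?thesis .
qed

lemma card_indicators: "card (indicators C) = card C"
  unfolding indicators_def by (rule card_image) (auto simp: inj_on_def fun_eq_iff)

lemma independent_indicators:
  assumes "finite C"
  shows "function_space.independent (indicators C)"
proof (rule function_space.independent_if_scalars_zero)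
  fix c and g :: "'a \<Rightarrow> complex"
  assume sum0: "(\<Sum>f\<in>indicators C. (\<lambda>x. c f * f x)) = 0" and "g \<in> indicators C"
  then obtain a where a: "a \<in> C" "g = (\<lambda>x. if x = a then 1 else 0)"
    by (auto simp: indicators_def)
  have inj: "inj_on (\<lambda>a x. if x = a then 1 else 0 :: complex) C"
    by (auto simp: inj_on_def fun_eq_iff)
  have "0 = (\<Sum>f\<in>indicators C. (\<lambda>x. c f * f x)) a" by (simp add: sum0)
  also have "\<dots> = (\<Sum>b\<in>C. if b = a then c g else 0)"
    unfolding sum_fun_apply indicators_def sum.reindex[OF inj] a(2)
    by (rule sum.cong) auto
  also have "\<dots> = c g" using a assms by simp
  finally show "c g = 0" by simp
qed (simp add: indicators_def assms)

section \<open>Linear characters of finite abelian groups\<close>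

text \<open>On a vector of finite period \<open>m\<close>, the discrete Fourier transform splits \<open>v\<close> into eigenvectors:
  with \<open>\<omega>\<close> a primitive \<open>m\<close>-th root of unity, the average of \<open>\<omega> ^ (j * k) *s (T ^^ j) v\<close> over
  \<open>j < m\<close> is an eigenvector for \<open>\<omega> ^ -k\<close>, and these averages sum to \<open>v\<close>. They stay in every
  \<open>T\<close>-invariant subspace \<open>U\<close> that contains \<open>v\<close>; this makes the splitting compatible with operators
  that have been diagonalised before.\<close>
lemma finite_order_span_eigenvectors:
  fixes scale :: "complex \<Rightarrow> 'v::ab_group_add \<Rightarrow> 'v" (infixr \<open>*s\<close> 75)
  assumes "vector_space scale" and lin: "Vector_Spaces.linear scale scale T"
    and period: "(T ^^ m) v = v" "0 < m"
    and U: "Modules.module.subspace scale U" "v \<in> U" "\<And>u. u \<in> U \<Longrightarrow> T u \<in> U"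
  shows "v \<in> Modules.module.span scale {u \<in> U. \<exists>c. T u = c *s u}"
proof -
  interpret vector_space scale by fact
  interpret T: Vector_Spaces.linear scale scale T by fact
  define \<omega> where "\<omega> = cis (2 * pi / real m)"
  have \<omega>_pow: "\<omega> ^ m = 1" using period(2) by (simp add: \<omega>_def DeMoivre)
  have \<omega>_nz: "\<omega> \<noteq> 0" by (simp add: \<omega>_def)
  have \<omega>_ne: "\<omega> ^ j \<noteq> 1" if "0 < j" "j < m" for j
  proof
    assume "\<omega> ^ j = 1"
    hence "cis (2 * pi * real j / real m) = cis (2 * pi * real 0 / real m)"
      by (simp add: \<omega>_def DeMoivre mult_ac)
    thus False
      using inj_onD[OF bij_betw_imp_inj_on[OF bij_betw_roots_unity[OF period(2)]], of j 0] that by simp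
  qed
  define g where "g k = (1 / of_nat m) *s (\<Sum>j<m. (\<omega> ^ (j * k)) *s (T ^^ j) v)" for k
  have iter_U: "(T ^^ j) v \<in> U" for j by (induction j) (auto intro: U)
  have g_U: "g k \<in> U" for k
    unfolding g_def using U(1) iter_U by (intro subspace_scale subspace_sum) auto
  have g_eigen: "T (g k) = (inverse \<omega> ^ k) *s g k" for k
  proof -
    let ?F = "\<lambda>j. (\<omega> ^ (j * k)) *s (T ^^ j) v"
    have "(\<Sum>j<m. ?F (Suc j)) + ?F 0 = (\<Sum>j<m. ?F j) + ?F m"
      using sum.lessThan_Suc_shift[of ?F m] sum.lessThan_Suc[of ?F m] by (simp only: add.commute)
    moreover have "?F m = ?F 0"
      using period(1) \<omega>_pow by (simp add: power_mult)
    ultimately have shift: "(\<Sum>j<m. ?F (Suc j)) = (\<Sum>j<m. ?F j)" by simp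
    have "T (g k) = (1 / of_nat m) *s (\<Sum>j<m. (\<omega> ^ (j * k)) *s (T ^^ Suc j) v)"
      by (simp add: g_def T.scale T.sum)
    also have "(\<Sum>j<m. (\<omega> ^ (j * k)) *s (T ^^ Suc j) v) = (inverse \<omega> ^ k) *s (\<Sum>j<m. ?F (Suc j))"
      unfolding scale_sum_right
      by (rule sum.cong) (use \<omega>_nz in \<open>auto simp: power_add field_simps\<close>)
    finally show ?thesis by (simp only: shift) (simp add: g_def mult.commute)
  qed
  have "(\<Sum>k<m. g k) = (1 / of_nat m) *s (\<Sum>j<m. (\<Sum>k<m. \<omega> ^ (j * k)) *s (T ^^ j) v)"
    unfolding g_def by (subst scale_sum_right[symmetric], subst sum.swap) (simp add: scale_sum_left)
  also have "(\<Sum>j<m. (\<Sum>k<m. \<omega> ^ (j * k)) *s (T ^^ j) v) = (\<Sum>j<m. if j = 0 then of_nat m *s v else 0)"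
  proof (rule sum.cong)
    fix j assume "j \<in> {..<m}"
    show "(\<Sum>k<m. \<omega> ^ (j * k)) *s (T ^^ j) v = (if j = 0 then of_nat m *s v else 0)"
    proof (cases "j = 0")
      case False
      hence "(\<Sum>k<m. (\<omega> ^ j) ^ k) = ((\<omega> ^ j) ^ m - 1) / (\<omega> ^ j - 1)"
        using \<omega>_ne[of j] \<open>j \<in> _\<close> by (intro geometric_sum) auto
      also have "(\<omega> ^ j) ^ m = 1"
        using \<omega>_pow by (metis power_commutes power_mult mult.commute power_one)
      finally show ?thesis using False by (simp add: power_mult)
    qed simp
  qed simp
  also have "(1 / of_nat m) *s \<dots> = v" using period(2) by simp
  finally have "v = (\<Sum>k<m. g k)" by simp
  also have "\<dots> \<in> span {u \<in> U. \<exists>c. T u = c *s u}"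
    using g_U g_eigen by (intro span_sum span_base) blast
  finally show ?thesis .
qed

text \<open>Homomorphisms to the multiplicative group of the complex numbers, extended by \<open>0\<close> outside the
  carrier. This extension makes characters that agree on the group equal, and it makes a
  character of a subgroup the generator of the representation induced from it.\<close>
definition linear_characters :: "('a, 'b) monoid_scheme \<Rightarrow> ('a \<Rightarrow> complex) set" where
  "linear_characters Q =
     {\<chi>. (\<forall>x\<in>carrier Q. \<forall>y\<in>carrier Q. \<chi> (x \<otimes>\<^bsub>Q\<^esub> y) = \<chi> x * \<chi> y) \<and> \<chi> \<one>\<^bsub>Q\<^esub> = 1 \<and>
          (\<forall>x. x \<notin> carrier Q \<longrightarrow> \<chi> x = 0)}"

text \<open>The right regular action on functions on the group.\<close>
definition translate :: "('a, 'b) monoid_scheme \<Rightarrow> 'a \<Rightarrow> ('a \<Rightarrow> complex) \<Rightarrow> 'a \<Rightarrow> complex" where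
  "translate G a f = (\<lambda>x. if x \<in> carrier G then f (x \<otimes>\<^bsub>G\<^esub> a) else 0)"

lemma linear_translate:
  "Vector_Spaces.linear (\<lambda>c (f :: 'a \<Rightarrow> complex) x. c * f x) (\<lambda>c f x. c * f x) (translate G a)"
  unfolding linear_function_space_iff by (auto simp: translate_def fun_eq_iff)

context group
begin

lemma translate_mult:
  "\<lbrakk>a \<in> carrier G; b \<in> carrier G\<rbrakk> \<Longrightarrow> translate G (a \<otimes> b) f = translate G a (translate G b f)"
  by (auto simp: translate_def fun_eq_iff m_assoc)

lemma translate_power:
  assumes "a \<in> carrier G" "\<And>x. x \<notin> carrier G \<Longrightarrow> f x = 0"
  shows "(translate G a ^^ j) f = translate G (a [^] j) f"
proof (induction j)
  case 0
  show ?case using assms by (auto simp: translate_def fun_eq_iff)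
next
  case (Suc j)
  show ?case
    using assms(1) nat_pow_Suc2[OF assms(1), of j] by (simp add: Suc.IH flip: translate_mult)
qed

end

text \<open>The translations by the elements of \<open>S\<close> are diagonalised simultaneously, one element at a time.
  The space \<open>U\<close> of common eigenfunctions for given eigenvalues \<open>\<mu>\<close> is invariant under
  translation by a further element \<open>a\<close> because the group is commutative.\<close>
lemma (in comm_group) supported_in_span_translate_eigenfunctions:
  assumes fin: "finite (carrier G)" and S: "finite S" "S \<subseteq> carrier G"
    and f: "\<And>x. x \<notin> carrier G \<Longrightarrow> f x = 0"
  shows "f \<in> function_space.span
    {g. (\<forall>x. x \<notin> carrier G \<longrightarrow> g x = 0) \<and> (\<forall>a\<in>S. \<exists>c. translate G a g = (\<lambda>x. c * g x))}"
  (is "f \<in> function_space.span (?E S)")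
  using S
proof (induction S rule: finite_induct)
  case empty
  show ?case using f by (intro function_space.span_base) auto
next
  case (insert a S)
  have a: "a \<in> carrier G" using insert.prems by auto
  have "g \<in> function_space.span (?E (insert a S))" if g: "g \<in> ?E S" for g
  proof -
    obtain \<mu> where \<mu>: "\<And>b. b \<in> S \<Longrightarrow> translate G b g = (\<lambda>x. \<mu> b * g x)" using g by auto metis
    define U where "U = {u. (\<forall>x. x \<notin> carrier G \<longrightarrow> u x = 0) \<and> (\<forall>b\<in>S. translate G b u = (\<lambda>x. \<mu> b * u x))}"
    have "g \<in> function_space.span {u \<in> U. \<exists>c. translate G a u = (\<lambda>x. c * u x)}"
    proof (rule finite_order_span_eigenvectors[OF function_space.vector_space_axioms linear_translate])
      show "(translate G a ^^ Coset.order G) g = g"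
        using g a pow_order_eq_1[OF a]
        by (subst translate_power) (auto simp: translate_def fun_eq_iff)
      show "0 < Coset.order G" using fin by (simp add: order_gt_0_iff_finite)
      show "function_space.subspace U"
        by (auto simp: function_space.subspace_def U_def translate_def fun_eq_iff algebra_simps)
      show "g \<in> U" using g \<mu> by (auto simp: U_def)
      fix u assume u: "u \<in> U"
      have "translate G b (translate G a u) = (\<lambda>x. \<mu> b * translate G a u x)" if b: "b \<in> S" for b
      proof -
        have bc: "b \<in> carrier G" using b insert.prems by auto
        have "translate G b (translate G a u) = translate G a (translate G b u)"
          using a bc by (simp add: m_comm flip: translate_mult)
        also have "\<dots> = (\<lambda>x. \<mu> b * translate G a u x)"
          using u b by (auto simp: U_def translate_def fun_eq_iff)
        finally show ?thesis .
      qed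
      thus "translate G a u \<in> U" by (auto simp: U_def translate_def)
    qed
    also have "\<dots> \<subseteq> function_space.span (?E (insert a S))"
      by (rule function_space.span_mono) (auto simp: U_def)
    finally show ?thesis .
  qed
  hence "function_space.span (?E S) \<subseteq> function_space.span (?E (insert a S))"
    by (intro function_space.span_minimal function_space.subspace_span) auto
  thus ?case using insert.IH insert.prems by auto
qed

text \<open>A function \<open>g\<close> that is an eigenfunction of all translations satisfies
  \<open>g (x \<otimes> a) = \<mu> a * g x\<close>, so it is \<open>g \<one>\<close> times a character. Hence the characters span the space
  of functions on the group, whose dimension is the order of the group. They are independent,
  since as translation eigenfunctions they have distinct weights, namely themselves.\<close>
theorem (in comm_group) card_linear_characters:
  assumes fin: "finite (carrier G)"
  shows "finite (linear_characters G) \<and> card (linear_characters G) = card (carrier G)"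
proof -
  have "finite (linear_characters G) \<and> card (linear_characters G) \<le> card (indicators (carrier G))"
  proof (rule function_space.card_weights_le[where T = "translate G" and A = "carrier G" and v = "\<lambda>\<chi>. \<chi>"])
    fix \<chi> a assume "\<chi> \<in> linear_characters G" "a \<in> carrier G"
    thus "translate G a \<chi> = (\<lambda>x. \<chi> a * \<chi> x)"
      by (auto simp: translate_def linear_characters_def fun_eq_iff)
  next
    fix \<chi> assume "\<chi> \<in> linear_characters G"
    hence "\<chi> \<one> = 1" by (simp add: linear_characters_def)
    thus "\<chi> \<noteq> 0" by auto
  next
    fix \<chi> \<psi> assume *: "\<chi> \<in> linear_characters G" "\<psi> \<in> linear_characters G" and eq: "\<And>a. a \<in> carrier G \<Longrightarrow> \<chi> a = \<psi> a"
    show "\<chi> = \<psi>"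
    proof
      fix x show "\<chi> x = \<psi> x" using * eq by (cases "x \<in> carrier G") (auto simp: linear_characters_def)
    qed
  next
    show "(\<lambda>\<chi>. \<chi>) ` linear_characters G \<subseteq> function_space.span (indicators (carrier G))"
      using in_span_indicators[OF fin] by (auto simp: linear_characters_def)
  qed (use fin in \<open>auto simp: linear_translate indicators_def\<close>)
  moreover have "indicators (carrier G) \<subseteq> function_space.span (linear_characters G)"
  proof
    fix f assume "f \<in> indicators (carrier G)"
    hence "f \<in> function_space.span {g. (\<forall>x. x \<notin> carrier G \<longrightarrow> g x = 0) \<and>
        (\<forall>a\<in>carrier G. \<exists>c. translate G a g = (\<lambda>x. c * g x))}"
      by (intro supported_in_span_translate_eigenfunctions fin subset_refl) (auto simp: indicators_def)
    also have "\<dots> \<subseteq> function_space.span (linear_characters G)"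
    proof (intro function_space.span_minimal function_space.subspace_span subsetI)
      fix g assume "g \<in> {g. (\<forall>x. x \<notin> carrier G \<longrightarrow> g x = 0) \<and>
        (\<forall>a\<in>carrier G. \<exists>c. translate G a g = (\<lambda>x. c * g x))}"
      hence supp: "\<And>x. x \<notin> carrier G \<Longrightarrow> g x = 0"
        and "\<forall>a\<in>carrier G. \<exists>c. \<forall>x. translate G a g x = c * g x" by (auto simp: fun_eq_iff)
      then obtain \<mu> where \<mu>: "\<And>a x. a \<in> carrier G \<Longrightarrow> translate G a g x = \<mu> a * g x" by metis
      have mult: "g (x \<otimes> a) = \<mu> a * g x" if "a \<in> carrier G" "x \<in> carrier G" for a x
        using \<mu>[OF that(1), of x] that(2) by (simp add: translate_def)
      have g_\<mu>: "g a = \<mu> a * g \<one>" if "a \<in> carrier G" for a using mult[OF that, of \<one>] that by simp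
      show "g \<in> function_space.span (linear_characters G)"
      proof (cases "g \<one> = 0")
        case True
        have "g x = 0" for x
          using supp[of x] g_\<mu>[of x] True by (cases "x \<in> carrier G") auto
        hence "g = 0" by (simp add: fun_eq_iff)
        thus ?thesis by (simp add: function_space.span_zero)
      next
        case False
        define \<chi> where "\<chi> x = g x / g \<one>" for x
        have "\<chi> \<in> linear_characters G"
          unfolding linear_characters_def
        proof (intro CollectI conjI ballI allI impI)
          fix x y assume "x \<in> carrier G" "y \<in> carrier G"
          thus "\<chi> (x \<otimes> y) = \<chi> x * \<chi> y"
            using False mult[of y x] g_\<mu>[of y] by (simp add: \<chi>_def)
        qed (use False supp in \<open>auto simp: \<chi>_def\<close>)
        hence "(\<lambda>x. g \<one> * \<chi> x) \<in> function_space.span (linear_characters G)"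
          by (intro function_space.span_scale function_space.span_base)
        thus ?thesis using False by (simp add: \<chi>_def)
      qed
    qed
    finally show "f \<in> function_space.span (linear_characters G)" .
  qed
  ultimately show ?thesis
    using function_space.independent_span_bound[OF _ independent_indicators[OF fin], of "linear_characters G"]
    by (auto simp: card_indicators)
qed

section \<open>Induction of linear characters\<close>

text \<open>Frobenius reciprocity in the form needed here: every linear character \<open>\<chi>\<close> of finite image of a
  subgroup of finite index occurs in an irreducible representation of \<open>G\<close> of finite image whose
  degree is at most the index. The function \<open>\<chi>\<close>, which vanishes outside \<open>H\<close>, generates under
  right translation the representation induced from \<open>\<chi>\<close>, and it is an eigenvector of \<open>H\<close> of
  weight \<open>\<chi>\<close>. Its translate by \<open>g\<close> depends, up to a value of \<open>\<chi>\<close>, only on the coset \<open>g H\<close>; this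
  bounds the dimension by the index and, as \<open>\<chi>\<close> takes finitely many values, shows that there are
  finitely many translates.\<close>
lemma (in group) irreducible_rep_with_character:
  assumes H: "subgroup H G" and fin_index: "finite (rcosets H)"
    and \<chi>: "\<chi> \<in> linear_characters (G\<lparr>carrier := H\<rparr>)" and fin_image: "finite (\<chi> ` H)"
  obtains e \<rho> w where "irreducible_rep G e \<rho>" "e \<le> card (rcosets H)" "finite (\<rho> ` carrier G)"
    and "w \<in> carrier_vec e" "w \<noteq> 0\<^sub>v e" "\<And>h. h \<in> H \<Longrightarrow> \<rho> h *\<^sub>v w = \<chi> h \<cdot>\<^sub>v w"
proof -
  interpret H: subgroup H G by fact
  have \<chi>_mult: "\<chi> (x \<otimes> y) = \<chi> x * \<chi> y" if "x \<in> H" "y \<in> H" for x y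
    using \<chi> that by (simp add: linear_characters_def)
  have \<chi>_one: "\<chi> \<one> = 1" and \<chi>_zero: "\<And>x. x \<notin> H \<Longrightarrow> \<chi> x = 0"
    using \<chi> by (simp_all add: linear_characters_def)
  have eigen: "translate G h \<chi> = (\<lambda>x. \<chi> h * \<chi> x)" if h: "h \<in> H" for h
  proof
    fix x
    have "x \<in> H" if "x \<in> carrier G" "x \<otimes> h \<in> H"
      using that h by (metis H.m_inv_closed H.m_closed H.mem_carrier inv_solve_right)
    thus "translate G h \<chi> x = \<chi> h * \<chi> x"
      using h \<chi>_mult \<chi>_zero H.mem_carrier[of x] by (cases "x \<in> H") (auto simp: translate_def)
  qed
  \<comment> \<open>The cosets at hand are right cosets, so the left coset of \<open>g\<close> is indexed by \<open>H #> inv g\<close> and a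
    representative is inverted.\<close>
  define rep where "rep C = (SOME r. r \<in> C)" for C :: "'a set"
  define B where "B = (\<lambda>C. translate G (inv (rep C)) \<chi>) ` (rcosets H)"
  have decomp: "\<exists>h\<in>H. \<exists>f\<in>B. translate G g \<chi> = (\<lambda>x. \<chi> h * f x)" if g: "g \<in> carrier G" for g
  proof -
    let ?C = "H #> inv g"
    have C: "?C \<in> rcosets H" using g by (auto simp: RCOSETS_def)
    have "rep ?C \<in> ?C"
      unfolding rep_def using rcos_self[OF inv_closed[OF g] H] by (rule someI)
    then obtain h where h: "h \<in> H" "rep ?C = h \<otimes> inv g" by (auto simp: r_coset_def)
    have "inv (rep ?C) \<otimes> h = g"
      using h g H.mem_carrier[OF h(1)] by (simp add: inv_mult_group m_assoc)
    moreover have "inv (rep ?C) \<in> carrier G"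
      using h g H.mem_carrier[OF h(1)] by simp
    ultimately have "translate G g \<chi> = translate G (inv (rep ?C)) (\<lambda>x. \<chi> h * \<chi> x)"
      using translate_mult[of "inv (rep ?C)" h \<chi>] H.mem_carrier[OF h(1)] eigen[OF h(1)] by simp
    also have "\<dots> = (\<lambda>x. \<chi> h * translate G (inv (rep ?C)) \<chi> x)"
      by (auto simp: translate_def fun_eq_iff)
    finally show ?thesis using h(1) C unfolding B_def by blast
  qed
  have fin_B: "finite B" "card B \<le> card (rcosets H)"
    unfolding B_def using fin_index card_image_le by auto
  have "(\<lambda>g. translate G g \<chi>) ` carrier G \<subseteq> (\<lambda>(c, f) x. c * f x) ` ((\<chi> ` H) \<times> B)"
  proof
    fix u assume "u \<in> (\<lambda>g. translate G g \<chi>) ` carrier G"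
    then obtain g where g: "g \<in> carrier G" "u = translate G g \<chi>" by auto
    obtain h f where "h \<in> H" "f \<in> B" "u = (\<lambda>x. \<chi> h * f x)" using decomp[OF g(1)] g(2) by auto
    thus "u \<in> (\<lambda>(c, f) x. c * f x) ` ((\<chi> ` H) \<times> B)" by (intro image_eqI[of _ _ "(\<chi> h, f)"]) auto
  qed
  hence fin_orbit: "finite ((\<lambda>g. translate G g \<chi>) ` carrier G)"
    using fin_image fin_B finite_subset by blast
  interpret cyclic_action "\<lambda>c (f :: 'a \<Rightarrow> complex) x. c * f x" G "translate G" \<chi>
  proof (intro cyclic_action.intro cyclic_action_axioms.intro)
    show "translate G \<one> \<chi> = \<chi>" using eigen[of \<one>] \<chi>_one by simp
    show "\<chi> \<noteq> 0" using \<chi>_one by auto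
  qed (simp_all add: fin_orbit linear_translate translate_mult function_space.vector_space_axioms group_axioms)
  have "translates \<subseteq> function_space.span B"
  proof
    fix u assume "u \<in> translates"
    then obtain g where g: "g \<in> carrier G" "u = translate G g \<chi>" by auto
    obtain h f where "f \<in> B" "u = (\<lambda>x. \<chi> h * f x)" using decomp[OF g(1)] g(2) by auto
    thus "u \<in> function_space.span B"
      using function_space.span_scale[OF function_space.span_base] by simp
  qed
  then obtain e \<rho> w where "irreducible_rep G e \<rho>" "e \<le> card B" "finite (\<rho> ` carrier G)"
    "w \<in> carrier_vec e" "w \<noteq> 0\<^sub>v e"
    and "\<And>x c. x \<in> carrier G \<Longrightarrow> translate G x \<chi> = (\<lambda>z. c * \<chi> z) \<Longrightarrow> \<rho> x *\<^sub>v w = c \<cdot>\<^sub>v w"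
    using irreducible_quotient[OF fin_B(1)] by blast
  thus ?thesis using that fin_B(2) eigen H.mem_carrier by (meson order_trans)
qed

section \<open>Characters of abelian sections\<close>

lemma (in group) abelian_quotient_if_derived_le:
  assumes K: "subgroup K G" and derived: "derived G (carrier G) \<subseteq> K"
  shows "K \<lhd> G" and "comm_group (G Mod K)"
proof -
  interpret K: subgroup K G by fact
  have comm: "x \<otimes> y \<otimes> inv x \<otimes> inv y \<in> K" if "x \<in> carrier G" "y \<in> carrier G" for x y
  proof -
    have "x \<otimes> y \<otimes> inv x \<otimes> inv y \<in> derived G (carrier G)"
      unfolding derived_def by (rule generate.incl) (use that in auto)
    thus ?thesis using derived by auto
  qed
  show normal: "K \<lhd> G"
  proof (rule normal_invI[OF K])
    fix x h assume xh: "x \<in> carrier G" "h \<in> K"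
    hence "(x \<otimes> h \<otimes> inv x \<otimes> inv h) \<otimes> h \<in> K"
      by (intro K.m_closed comm) auto
    thus "x \<otimes> h \<otimes> inv x \<in> K" using xh by (simp add: m_assoc)
  qed
  interpret KN: normal K G by (rule normal)
  show "comm_group (G Mod K)"
  proof (rule group.group_comm_groupI[OF KN.factorgroup_is_group])
    fix C D assume "C \<in> carrier (G Mod K)" "D \<in> carrier (G Mod K)"
    then obtain x y where xy: "x \<in> carrier G" "y \<in> carrier G" and CD: "C = K #> x" "D = K #> y"
      by (auto simp: carrier_FactGroup)
    have "x \<otimes> y = (x \<otimes> y \<otimes> inv x \<otimes> inv y) \<otimes> (y \<otimes> x)" using xy by (simp add: m_assoc) (simp flip: m_assoc)
    hence "x \<otimes> y \<in> K #> (y \<otimes> x)" using comm[OF xy] by (auto simp: r_coset_def)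
    hence "K #> (y \<otimes> x) = K #> (x \<otimes> y)" using xy K by (intro repr_independence) auto
    thus "C \<otimes>\<^bsub>G Mod K\<^esub> D = D \<otimes>\<^bsub>G Mod K\<^esub> C"
      using xy by (simp add: CD KN.rcos_sum)
  qed
qed

lemma rel_abelianization_quotient:
  fixes G (structure)
  assumes G: "group G" and H: "subgroup H G" and Y: "subgroup Y G" "Y \<subseteq> H"
  shows "derived G H <#> Y \<lhd> G\<lparr>carrier := H\<rparr>"
    and "comm_group (rel_abelianization G H Y)"
    and "Y \<subseteq> derived G H <#> Y"
proof -
  interpret group G by (rule G)
  interpret L: group "G\<lparr>carrier := H\<rparr>" by (rule subgroup.subgroup_is_group[OF H G])
  have der: "derived (G\<lparr>carrier := H\<rparr>) H = derived G H" by (rule derived_consistent[OF subset_refl H])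
  have "subgroup Y (G\<lparr>carrier := H\<rparr>)" by (rule subgroup_incl[OF Y(1) H Y(2)])
  hence K: "subgroup (derived G H <#> Y) (G\<lparr>carrier := H\<rparr>)"
    using L.mult_norm_subgroup[OF L.derived_self_is_normal] by (simp add: der set_mult_def)
  have one: "\<one> \<in> Y" "\<one> \<in> derived G H"
    using subgroup.one_closed[OF Y(1)] subgroup.one_closed[OF derived_is_subgroup[OF subgroup.subset[OF H]]] by auto
  have car: "derived G H \<subseteq> carrier G" "Y \<subseteq> carrier G"
    using derived_in_carrier[OF subgroup.subset[OF H]] subgroup.subset[OF Y(1)] by auto
  show "Y \<subseteq> derived G H <#> Y"
  proof
    fix y assume "y \<in> Y"
    moreover from this have "y = \<one> \<otimes> y" using car(2) by auto
    ultimately show "y \<in> derived G H <#> Y" using one(2) unfolding set_mult_def by blast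
  qed
  have "derived G H \<subseteq> derived G H <#> Y"
  proof
    fix d assume "d \<in> derived G H"
    moreover from this have "d = d \<otimes> \<one>" using car(1) by auto
    ultimately show "d \<in> derived G H <#> Y" using one(1) unfolding set_mult_def by blast
  qed
  hence "derived (G\<lparr>carrier := H\<rparr>) (carrier (G\<lparr>carrier := H\<rparr>)) \<subseteq> derived G H <#> Y" by (simp add: der)
  from L.abelian_quotient_if_derived_le[OF K this]
  show "derived G H <#> Y \<lhd> G\<lparr>carrier := H\<rparr>" "comm_group (rel_abelianization G H Y)"
    by (simp_all add: rel_abelianization_def)
qed

lemma pullback_linear_characters:
  assumes h: "h \<in> hom L Q" "h ` carrier L = carrier Q" "h \<one>\<^bsub>L\<^esub> = \<one>\<^bsub>Q\<^esub>" and L: "group L"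
  shows "(\<lambda>\<chi> x. if x \<in> carrier L then \<chi> (h x) else 0) ` linear_characters Q \<subseteq> linear_characters L"
    and "inj_on (\<lambda>\<chi> x. if x \<in> carrier L then \<chi> (h x) else 0) (linear_characters Q)"
proof -
  interpret group L by (rule L)
  have hQ: "h x \<in> carrier Q" if "x \<in> carrier L" for x using h(1) that by (auto simp: hom_def)
  show "(\<lambda>\<chi> x. if x \<in> carrier L then \<chi> (h x) else 0) ` linear_characters Q \<subseteq> linear_characters L"
    using h(3) hQ hom_mult[OF h(1)] by (auto simp: linear_characters_def)
  show "inj_on (\<lambda>\<chi> x. if x \<in> carrier L then \<chi> (h x) else 0) (linear_characters Q)"
  proof (intro inj_onI ext)
    fix \<chi> \<psi> q assume chars: "\<chi> \<in> linear_characters Q" "\<psi> \<in> linear_characters Q"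
      and eq: "(\<lambda>x. if x \<in> carrier L then \<chi> (h x) else 0) = (\<lambda>x. if x \<in> carrier L then \<psi> (h x) else 0)"
    show "\<chi> q = \<psi> q"
    proof (cases "q \<in> carrier Q")
      case True
      then obtain x where "x \<in> carrier L" "q = h x" using h(2) by auto
      thus ?thesis using fun_cong[OF eq, of x] by simp
    qed (use chars in \<open>auto simp: linear_characters_def\<close>)
  qed
qed

text \<open>Each finite quotient \<open>A / N\<close> of the abelian group \<open>A = L / K\<close> contributes \<open>|A / N|\<close> characters of
  \<open>L\<close>. Passing to \<open>N\<close> serves infinite \<open>A\<close>: only characters of finite image can be induced to
  representations of finite image.\<close>
lemma characters_of_finite_abelian_quotient:
  fixes L (structure)
  assumes L: "group L" and K: "K \<lhd> L" and comm: "comm_group (L Mod K)"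
    and N: "subgroup N (L Mod K)" "finite (rcosets\<^bsub>L Mod K\<^esub> N)"
  obtains Z where "Z \<subseteq> linear_characters L" "finite Z" "card Z = card (rcosets\<^bsub>L Mod K\<^esub> N)"
    and "\<And>\<chi>. \<chi> \<in> Z \<Longrightarrow> finite (\<chi> ` carrier L)" "\<And>\<chi> k. \<chi> \<in> Z \<Longrightarrow> k \<in> K \<Longrightarrow> \<chi> k = 1"
proof -
  interpret L: group L by fact
  interpret K: normal K L by fact
  interpret A: comm_group "L Mod K" by fact
  have N_normal: "N \<lhd> L Mod K" using N(1) by (simp add: A.normal_iff_subgroup)
  interpret N: normal N "L Mod K" by (rule N_normal)
  let ?Q = "L Mod K Mod N"
  interpret Q: comm_group ?Q by (rule A.abelian_FactGroup[OF N(1)])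
  have Q_car: "carrier ?Q = rcosets\<^bsub>L Mod K\<^esub> N" by (simp add: FactGroup_def)
  define h where "h x = N #>\<^bsub>L Mod K\<^esub> (K #>\<^bsub>L\<^esub> x)" for x
  have h_hom: "h \<in> hom L ?Q"
    unfolding h_def using hom_compose[OF K.r_coset_hom_Mod N.r_coset_hom_Mod] by (simp add: comp_def)
  have h_surj: "h ` carrier L = carrier ?Q"
    by (simp add: h_def carrier_FactGroup image_image)
  have h_K: "h k = \<one>\<^bsub>?Q\<^esub>" if "k \<in> K" for k
  proof -
    have "K #> k = K" using that K.mem_carrier[OF that] K.subgroup_axioms by (intro L.coset_join2)
    thus ?thesis using A.coset_join2[OF A.one_closed N(1) N.one_closed] by (simp add: h_def)
  qed
  have h_one: "h \<one> = \<one>\<^bsub>?Q\<^esub>" by (rule h_K) simp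
  define pull where "pull \<chi> = (\<lambda>x. if x \<in> carrier L then \<chi> (h x) else 0 :: complex)" for \<chi>
  have pull: "pull ` linear_characters ?Q \<subseteq> linear_characters L" "inj_on pull (linear_characters ?Q)"
    using pullback_linear_characters[OF h_hom h_surj h_one L] by (simp_all add: pull_def[abs_def])
  have count: "finite (linear_characters ?Q)" "card (linear_characters ?Q) = card (rcosets\<^bsub>L Mod K\<^esub> N)"
    using Q.card_linear_characters N(2) by (simp_all add: Q_car)
  show ?thesis
  proof (rule that[of "pull ` linear_characters ?Q"])
    show "card (pull ` linear_characters ?Q) = card (rcosets\<^bsub>L Mod K\<^esub> N)"
      using count pull(2) by (simp add: card_image)
    fix \<chi> assume "\<chi> \<in> pull ` linear_characters ?Q"
    then obtain \<psi> where \<psi>: "\<psi> \<in> linear_characters ?Q" "\<chi> = pull \<psi>" by auto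
    have "\<chi> ` carrier L = \<psi> ` carrier ?Q" by (auto simp: \<psi>(2) pull_def simp flip: h_surj)
    thus "finite (\<chi> ` carrier L)" using N(2) by (simp add: Q_car)
    fix k assume "k \<in> K"
    thus "\<chi> k = 1" using h_K \<psi> K.mem_carrier by (simp add: pull_def linear_characters_def)
  qed (use count pull(1) in auto)
qed

section \<open>Restriction of representations and counting\<close>

text \<open>\<open>\<chi>\<close> occurs in the restriction to \<open>H\<close> of the given representation.\<close>
definition is_weight :: "'a set \<Rightarrow> nat \<times> ('a \<Rightarrow> complex mat) \<Rightarrow> ('a \<Rightarrow> complex) \<Rightarrow> bool" where
  "is_weight H = (\<lambda>(d, \<rho>) \<chi>.
     \<exists>w\<in>carrier_vec d. w \<noteq> 0\<^sub>v d \<and> (\<forall>h\<in>H. \<rho> h *\<^sub>v w = \<chi> h \<cdot>\<^sub>v w))"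

lemma card_weights_le_degree:
  fixes \<rho> :: "'a \<Rightarrow> complex mat"
  assumes \<rho>: "\<And>h. h \<in> H \<Longrightarrow> \<rho> h \<in> carrier_mat d d"
    and weight: "\<And>\<chi>. \<chi> \<in> Z \<Longrightarrow> is_weight H (d, \<rho>) \<chi>"
    and supp: "\<And>\<chi> x. \<chi> \<in> Z \<Longrightarrow> x \<notin> H \<Longrightarrow> \<chi> x = 0"
  shows "finite Z \<and> card Z \<le> d"
proof -
  obtain w where w: "\<And>\<chi>. \<chi> \<in> Z \<Longrightarrow> w \<chi> \<in> carrier_vec d \<and> w \<chi> \<noteq> 0\<^sub>v d \<and> (\<forall>h\<in>H. \<rho> h *\<^sub>v w \<chi> = \<chi> h \<cdot>\<^sub>v w \<chi>)"
    using weight unfolding is_weight_def prod.case by metis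
  \<comment> \<open>Vectors of length \<open>d\<close> are read as functions that vanish from \<open>d\<close> on.\<close>
  define T where "T h f = (\<lambda>i. if i < d then \<Sum>j<d. \<rho> h $$ (i,j) * f j else 0)" for h and f :: "nat \<Rightarrow> complex"
  define v where "v \<chi> = (\<lambda>i. if i < d then w \<chi> $ i else 0)" for \<chi>
  have "finite Z \<and> card Z \<le> card (indicators {..<d})"
  proof (rule function_space.card_weights_le[where T = T and A = H and v = v])
    show "Vector_Spaces.linear (\<lambda>c f x. c * f x) (\<lambda>c f x. c * f x) (T h)" for h
      unfolding linear_function_space_iff T_def
      by (auto simp: fun_eq_iff sum.distrib sum_distrib_left algebra_simps)
  next
    fix \<chi> h assume \<chi>: "\<chi> \<in> Z" and h: "h \<in> H"
    show "T h (v \<chi>) = (\<lambda>i. \<chi> h * v \<chi> i)"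
    proof
      fix i
      show "T h (v \<chi>) i = \<chi> h * v \<chi> i"
      proof (cases "i < d")
        case True
        have "(\<rho> h *\<^sub>v w \<chi>) $ i = (\<chi> h \<cdot>\<^sub>v w \<chi>) $ i" using w[OF \<chi>] h by simp
        moreover have "w \<chi> \<in> carrier_vec d" using w[OF \<chi>] by simp
        ultimately show ?thesis using True \<rho>[OF h]
          by (simp add: T_def v_def scalar_prod_def atLeast0LessThan)
      qed (simp add: T_def v_def)
    qed
  next
    fix \<chi> assume \<chi>: "\<chi> \<in> Z"
    show "v \<chi> \<noteq> 0"
    proof
      assume "v \<chi> = 0"
      hence "w \<chi> $ i = 0" if "i < d" for i using that by (auto simp: v_def fun_eq_iff split: if_splits)
      hence "w \<chi> = 0\<^sub>v d" using w[OF \<chi>] by (intro eq_vecI) auto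
      thus False using w[OF \<chi>] by simp
    qed
  next
    fix \<chi> \<psi> assume *: "\<chi> \<in> Z" "\<psi> \<in> Z" and eq: "\<And>h. h \<in> H \<Longrightarrow> \<chi> h = \<psi> h"
    show "\<chi> = \<psi>"
    proof
      fix x show "\<chi> x = \<psi> x" using supp[OF *(1), of x] supp[OF *(2), of x] eq[of x] by (cases "x \<in> H") auto
    qed
  next
    show "v ` Z \<subseteq> function_space.span (indicators {..<d})"
      using in_span_indicators[of "{..<d}"] by (auto simp: v_def)
  qed (simp add: indicators_def)
  thus ?thesis by (simp add: card_indicators)
qed

lemma general_linear_group_carrier:
  "P \<in> carrier (general_linear_group d) \<longleftrightarrow>
     P \<in> carrier_mat d d \<and> (\<exists>Q\<in>carrier_mat d d. Q * P = 1\<^sub>m d \<and> P * Q = 1\<^sub>m d)"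
  by (auto simp: general_linear_group_def units_of_def Units_def ring_mat_def)

lemma irreducible_rep_carrier_mat:
  "irreducible_rep G d \<rho> \<Longrightarrow> x \<in> carrier G \<Longrightarrow> \<rho> x \<in> carrier_mat d d"
  by (auto simp: irreducible_rep_def hom_def general_linear_group_carrier)

lemma irreducible_rep_mult:
  "irreducible_rep G d \<rho> \<Longrightarrow> x \<in> carrier G \<Longrightarrow> y \<in> carrier G \<Longrightarrow> \<rho> (x \<otimes>\<^bsub>G\<^esub> y) = \<rho> x * \<rho> y"
  by (auto simp: irreducible_rep_def hom_def general_linear_group_def units_of_def ring_mat_def)

lemma equivalent_reps_refl:
  assumes "(d, \<rho>) \<in> irreps n G Y"
  shows "((d, \<rho>), (d, \<rho>)) \<in> equivalent_reps G"
proof -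
  have "1\<^sub>m d * \<rho> x = \<rho> x * 1\<^sub>m d" if "x \<in> carrier G" for x
    using irreducible_rep_carrier_mat[of G d \<rho> x] that assms by (simp add: irreps_def)
  moreover have "1\<^sub>m d \<in> carrier (general_linear_group d)"
    by (auto simp: general_linear_group_carrier intro: bexI[of _ "1\<^sub>m d"])
  ultimately show ?thesis by (auto simp: equivalent_reps_def)
qed

lemma is_weight_equivalent:
  assumes equiv: "((d, \<sigma>), (e, \<rho>)) \<in> equivalent_reps G"
    and \<sigma>: "irreducible_rep G d \<sigma>" and \<rho>: "irreducible_rep G e \<rho>" and "H \<subseteq> carrier G" "is_weight H (d, \<sigma>) \<chi>"
  shows "is_weight H (e, \<rho>) \<chi>"
proof -
  have [simp]: "e = d" using equiv by (auto simp: equivalent_reps_def)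
  obtain P where "P \<in> carrier (general_linear_group d)"
    and intertwines: "\<And>x. x \<in> carrier G \<Longrightarrow> P * \<sigma> x = \<rho> x * P"
    using equiv by (auto simp: equivalent_reps_def)
  then obtain Q where P: "P \<in> carrier_mat d d" and Q: "Q \<in> carrier_mat d d" "Q * P = 1\<^sub>m d"
    by (auto simp: general_linear_group_carrier)
  obtain w where w: "w \<in> carrier_vec d" "w \<noteq> 0\<^sub>v d" "\<And>h. h \<in> H \<Longrightarrow> \<sigma> h *\<^sub>v w = \<chi> h \<cdot>\<^sub>v w"
    using assms(5) by (auto simp: is_weight_def)
  have "Q *\<^sub>v (P *\<^sub>v w) = w"
    using Q P w(1) by (simp flip: assoc_mult_mat_vec)
  moreover have "Q *\<^sub>v 0\<^sub>v d = 0\<^sub>v d"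
    using Q(1) by (intro eq_vecI) (auto simp: scalar_prod_def)
  ultimately have "P *\<^sub>v w \<noteq> 0\<^sub>v d" using w(2) by metis
  moreover have "\<rho> h *\<^sub>v (P *\<^sub>v w) = \<chi> h \<cdot>\<^sub>v (P *\<^sub>v w)" if "h \<in> H" for h
  proof -
    have h: "h \<in> carrier G" using that assms(4) by auto
    note mats = irreducible_rep_carrier_mat[OF \<sigma> h] irreducible_rep_carrier_mat[OF \<rho> h, simplified]
    have "\<rho> h *\<^sub>v (P *\<^sub>v w) = (P * \<sigma> h) *\<^sub>v w"
      using P mats w(1) intertwines[OF h] by (simp add: assoc_mult_mat_vec[of _ d d])
    also have "\<dots> = P *\<^sub>v (\<chi> h \<cdot>\<^sub>v w)"
      using P mats w(1) w(3)[OF that] by (simp add: assoc_mult_mat_vec[of _ d d])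
    also have "\<dots> = \<chi> h \<cdot>\<^sub>v (P *\<^sub>v w)"
      using P w(1) by (simp add: mult_mat_vec)
    finally show ?thesis .
  qed
  ultimately show ?thesis using P w(1) by (auto simp: is_weight_def intro!: bexI[of _ "P *\<^sub>v w"])
qed

text \<open>Send each character to the class of an irreducible representation in which it occurs. The
  eigenvector of \<open>H\<close> is fixed by \<open>Y\<close>, where the character is trivial, so the representation is one
  of those that are counted. Characters with the same image occur in one and the same
  representation, whose degree is at most \<open>n\<close>; hence the fibres have at most \<open>n\<close> elements.\<close>
lemma (in group) card_characters_le_Rep:
  assumes H: "subgroup H G" and index: "finite (rcosets H)" "card (rcosets H) \<le> n"
    and Y: "Y \<subseteq> H"
    and Z: "Z \<subseteq> linear_characters (G\<lparr>carrier := H\<rparr>)" "finite Z"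
      "\<And>\<chi>. \<chi> \<in> Z \<Longrightarrow> finite (\<chi> ` H)" "\<And>\<chi> y. \<chi> \<in> Z \<Longrightarrow> y \<in> Y \<Longrightarrow> \<chi> y = 1"
  shows "enat (card Z) \<le> enat n * Rep n G Y"
proof -
  let ?I = "irreps n G Y"
  let ?E = "equivalent_reps G \<inter> ?I \<times> ?I"
  have "\<exists>a\<in>?I. is_weight H a \<chi>" if \<chi>: "\<chi> \<in> Z" for \<chi>
  proof -
    obtain e \<rho> w where \<rho>: "irreducible_rep G e \<rho>" "e \<le> card (rcosets H)" "finite (\<rho> ` carrier G)"
      and w: "w \<in> carrier_vec e" "w \<noteq> 0\<^sub>v e" "\<And>h. h \<in> H \<Longrightarrow> \<rho> h *\<^sub>v w = \<chi> h \<cdot>\<^sub>v w"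
      using irreducible_rep_with_character[OF H index(1) _ Z(3)[OF \<chi>]] Z(1) \<chi> by blast
    have "has_nonzero_fixed_vector Y e \<rho>"
      unfolding has_nonzero_fixed_vector_def using w Z(4)[OF \<chi>] Y by (intro bexI[of _ w]) auto
    hence "(e, \<rho>) \<in> ?I" using \<rho> index(2) by (auto simp: irreps_def)
    moreover have "is_weight H (e, \<rho>) \<chi>" unfolding is_weight_def using w by auto
    ultimately show ?thesis by blast
  qed
  then obtain a where a: "\<And>\<chi>. \<chi> \<in> Z \<Longrightarrow> a \<chi> \<in> ?I" "\<And>\<chi>. \<chi> \<in> Z \<Longrightarrow> is_weight H (a \<chi>) \<chi>"
    by metis
  define cls where "cls \<chi> = ?E `` {a \<chi>}" for \<chi>
  have cls_quotient: "cls ` Z \<subseteq> ?I // ?E"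
    using a(1) by (auto simp: cls_def intro!: quotientI)
  have fibre: "card {\<chi> \<in> Z. cls \<chi> = C} \<le> n" if C: "C \<in> cls ` Z" for C
  proof -
    obtain \<chi>\<^sub>0 where \<chi>\<^sub>0: "\<chi>\<^sub>0 \<in> Z" "C = cls \<chi>\<^sub>0" using C by auto
    obtain d \<rho> where d: "a \<chi>\<^sub>0 = (d, \<rho>)" by fastforce
    have \<rho>: "(d, \<rho>) \<in> ?I" using a(1)[OF \<chi>\<^sub>0(1)] d by simp
    hence irr: "irreducible_rep G d \<rho>" "d \<le> n" by (auto simp: irreps_def)
    have "finite {\<chi> \<in> Z. cls \<chi> = C} \<and> card {\<chi> \<in> Z. cls \<chi> = C} \<le> d"
    proof (rule card_weights_le_degree)
      show "\<rho> h \<in> carrier_mat d d" if "h \<in> H" for h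
        using irreducible_rep_carrier_mat[OF irr(1)] subgroup.mem_carrier[OF H that] by blast
      show "\<chi> x = 0" if "\<chi> \<in> {\<chi> \<in> Z. cls \<chi> = C}" "x \<notin> H" for \<chi> x
        using that Z(1) by (auto simp: linear_characters_def)
      fix \<chi> assume "\<chi> \<in> {\<chi> \<in> Z. cls \<chi> = C}"
      hence \<chi>: "\<chi> \<in> Z" "cls \<chi> = C" by auto
      obtain d' \<sigma> where \<sigma>: "a \<chi> = (d', \<sigma>)" by fastforce
      have "(d, \<rho>) \<in> cls \<chi>\<^sub>0"
        using equivalent_reps_refl[OF \<rho>] \<rho> by (simp add: cls_def d)
      hence "(d, \<rho>) \<in> cls \<chi>" using \<chi>(2) \<chi>\<^sub>0(2) by simp
      hence "((d', \<sigma>), (d, \<rho>)) \<in> ?E" by (simp add: cls_def \<sigma>)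
      moreover have "irreducible_rep G d' \<sigma>" using a(1)[OF \<chi>(1)] by (simp add: \<sigma> irreps_def)
      ultimately show "is_weight H (d, \<rho>) \<chi>"
        using is_weight_equivalent[of d' \<sigma> d \<rho> G H \<chi>] irr(1) a(2)[OF \<chi>(1)] subgroup.subset[OF H]
        by (simp add: \<sigma>)
    qed
    thus ?thesis using irr(2) by simp
  qed
  show ?thesis
  proof (cases "finite (?I // ?E)")
    case True
    have "card Z \<le> (\<Sum>C\<in>cls ` Z. card {\<chi> \<in> Z. cls \<chi> = C})"
    proof -
      have "Z = (\<Union>C\<in>cls ` Z. {\<chi> \<in> Z. cls \<chi> = C})" by auto
      thus ?thesis using card_UN_le[of "cls ` Z" "\<lambda>C. {\<chi> \<in> Z. cls \<chi> = C}"] Z(2) by simp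
    qed
    also have "\<dots> \<le> card (cls ` Z) * n" using fibre by (intro order.trans[OF sum_bounded_above]) auto
    also have "\<dots> \<le> card (?I // ?E) * n" using True cls_quotient by (intro mult_right_mono card_mono) auto
    finally show ?thesis using True by (simp add: Rep_def ecard_def mult.commute)
  next
    case False
    \<comment> \<open>In the product with \<open>\<infinity>\<close> the factor \<open>n\<close> must not vanish; there are no representations of
      degree \<open>0\<close>.\<close>
    have "n \<noteq> 0"
    proof
      assume "n = 0"
      hence "irreps n G Y = {}" by (auto simp: irreps_def irreducible_rep_def)
      thus False using False by simp
    qed
    thus ?thesis using False by (simp add: Rep_def ecard_def enat_0_iff)
  qed
qed

lemma card_rcosets_le_Rep:
  fixes G (structure)
  assumes G: "group G" and Y: "subgroup Y G" and H: "H \<in> intermediate_subgroups G Y n"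
    and N: "subgroup N (rel_abelianization G H Y)" "finite (rcosets\<^bsub>rel_abelianization G H Y\<^esub> N)"
  shows "enat (card (rcosets\<^bsub>rel_abelianization G H Y\<^esub> N)) \<le> enat n * Rep n G Y"
proof -
  have sub: "subgroup H G" "Y \<subseteq> H" and index: "finite (rcosets H)" "card (rcosets H) \<le> n"
    using H by (auto simp: intermediate_subgroups_def ecard_def split: if_splits)
  note quot = rel_abelianization_quotient[OF G sub(1) Y sub(2)]
  obtain Z where Z: "Z \<subseteq> linear_characters (G\<lparr>carrier := H\<rparr>)" "finite Z"
    and card_Z: "card Z = card (rcosets\<^bsub>rel_abelianization G H Y\<^esub> N)"
    and image: "\<And>\<chi>. \<chi> \<in> Z \<Longrightarrow> finite (\<chi> ` H)"
    and trivial: "\<And>\<chi> k. \<chi> \<in> Z \<Longrightarrow> k \<in> derived G H <#> Y \<Longrightarrow> \<chi> k = 1"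
    using characters_of_finite_abelian_quotient[OF subgroup.subgroup_is_group[OF sub(1) G] quot(1)
        quot(2)[unfolded rel_abelianization_def] N[unfolded rel_abelianization_def]]
    unfolding rel_abelianization_def by auto
  have "\<chi> y = 1" if "\<chi> \<in> Z" "y \<in> Y" for \<chi> y
    using trivial[OF that(1)] that(2) quot(3) by blast
  with group.card_characters_le_Rep[OF G sub(1) index sub(2) Z image] show ?thesis
    by (simp add: card_Z)
qed

text \<open>For a finite section the trivial subgroup gives the bound by the whole section. An infinite
  section has finite quotients of unbounded size, which force the right-hand side to be infinite.\<close>
theorem ab_le_mult_Rep:
  fixes G (structure)
  assumes G: "group G" and Y: "subgroup Y G" and visible: "infinite_sections_visible n G Y"
  shows "ab n G Y \<le> enat n * Rep n G Y"
  unfolding ab_def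
proof (rule SUP_least)
  fix H assume H: "H \<in> intermediate_subgroups G Y n"
  let ?A = "rel_abelianization G H Y"
  have sub: "subgroup H G" "Y \<subseteq> H" using H by (auto simp: intermediate_subgroups_def)
  interpret A: comm_group ?A by (rule rel_abelianization_quotient[OF G sub(1) Y sub(2)])
  show "ecard (carrier ?A) \<le> enat n * Rep n G Y"
  proof (cases "finite (carrier ?A)")
    case True
    have "card (rcosets\<^bsub>?A\<^esub> {\<one>\<^bsub>?A\<^esub>}) = card (carrier ?A)"
      using A.lagrange[OF A.triv_subgroup] by (simp add: Coset.order_def)
    moreover have "finite (rcosets\<^bsub>?A\<^esub> {\<one>\<^bsub>?A\<^esub>})"
      using True by (simp add: RCOSETS_def)
    ultimately show ?thesis
      using card_rcosets_le_Rep[OF G Y H A.triv_subgroup] True by (simp add: ecard_def)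
  next
    case False
    have "enat m \<le> enat n * Rep n G Y" for m
    proof -
      obtain N where N: "subgroup N ?A" "finite (rcosets\<^bsub>?A\<^esub> N)" "m \<le> card (rcosets\<^bsub>?A\<^esub> N)"
        using visible H False unfolding infinite_sections_visible_def by blast
      have "enat m \<le> enat (card (rcosets\<^bsub>?A\<^esub> N))" using N(3) by simp
      also have "\<dots> \<le> enat n * Rep n G Y" by (rule card_rcosets_le_Rep[OF G Y H N(1,2)])
      finally show ?thesis .
    qed
    hence "enat n * Rep n G Y = \<infinity>"
      by (metis enat_ord_simps(1) not_enat_eq not_less_eq_eq order_refl)
    thus ?thesis by simp
  qed
qed

text \<open>A representation of degree one is trivial on commutators, because the complex numbers commute,
  and on \<open>Y\<close>, because a nonzero fixed vector spans the space. So it is a character of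
  the relative abelianization.\<close>
lemma (in group) linear_character_of_degree_one_rep:
  assumes Y: "subgroup Y G" and \<rho>: "(d, \<rho>) \<in> irreps 1 G Y"
  obtains \<chi> where "\<chi> \<in> linear_characters (rel_abelianization G (carrier G) Y)"
    and "\<And>x. x \<in> carrier G \<Longrightarrow> \<rho> x = mat 1 1 (\<lambda>_. \<chi> ((derived G (carrier G) <#> Y) #> x))"
proof -
  let ?K = "derived G (carrier G) <#> Y"
  have irr: "irreducible_rep G 1 \<rho>" and d: "d = 1" and fixed: "has_nonzero_fixed_vector Y 1 \<rho>"
    using \<rho> by (auto simp: irreps_def irreducible_rep_def less_Suc_eq_le le_antisym Suc_leI dest: le_antisym)
  have same: "G\<lparr>carrier := carrier G\<rparr> = G" by simp
  note quot = rel_abelianization_quotient[OF is_group subgroup_self Y subgroup.subset[OF Y], unfolded same rel_abelianization_def]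
  interpret K: normal ?K G by (rule quot(1))
  define f where "f x = \<rho> x $$ (0,0)" for x
  note car = irreducible_rep_carrier_mat[OF irr]
  have \<rho>_f: "\<rho> x = mat 1 1 (\<lambda>_. f x)" if "x \<in> carrier G" for x
    using car[OF that] by (intro eq_matI) (auto simp: f_def)
  have f_mult: "f (x \<otimes> y) = f x * f y" if "x \<in> carrier G" "y \<in> carrier G" for x y
    using irreducible_rep_mult[OF irr that] car[OF that(1)] car[OF that(2)]
    by (simp add: f_def scalar_prod_def)
  have f_nonzero: "f x \<noteq> 0" if "x \<in> carrier G" for x
  proof
    assume f0: "f x = 0"
    have "\<rho> x \<in> carrier (general_linear_group 1)" using irr that by (auto simp: irreducible_rep_def hom_def)
    then obtain Q where Q: "Q \<in> carrier_mat 1 1" "Q * \<rho> x = 1\<^sub>m 1"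
      by (auto simp: general_linear_group_carrier)
    have "(Q * \<rho> x) $$ (0,0) = Q $$ (0,0) * f x"
      using car[OF that] Q(1) by (simp add: f_def scalar_prod_def)
    thus False using f0 Q(2) by simp
  qed
  have f_one: "f \<one> = 1" using f_mult[of \<one> \<one>] f_nonzero[of \<one>] by simp
  have f_inv: "f (inv x) = 1 / f x" if "x \<in> carrier G" for x
    using f_mult[of x "inv x"] f_nonzero[OF that] that by (simp add: f_one field_simps)
  have f_Y: "f y = 1" if y: "y \<in> Y" for y
  proof -
    obtain v where v: "v \<in> carrier_vec 1" "v \<noteq> 0\<^sub>v 1" "\<rho> y *\<^sub>v v = v"
      using fixed y by (auto simp: has_nonzero_fixed_vector_def)
    have "v $ 0 \<noteq> 0"
    proof
      assume "v $ 0 = 0"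
      hence "v = 0\<^sub>v 1" using v(1) by (intro eq_vecI) auto
      thus False using v(2) by simp
    qed
    moreover have "(\<rho> y *\<^sub>v v) $ 0 = f y * v $ 0"
      using car[OF subgroup.mem_carrier[OF Y y]] v(1) by (simp add: f_def scalar_prod_def)
    ultimately show ?thesis using v(3) by simp
  qed
  have "derived G (carrier G) \<subseteq> {x \<in> carrier G. f x = 1}"
    unfolding derived_def
  proof (rule generate_subgroup_incl)
    show "subgroup {x \<in> carrier G. f x = 1} G"
      by (rule subgroupI) (use f_one f_inv f_mult in auto)
    show "derived_set G (carrier G) \<subseteq> {x \<in> carrier G. f x = 1}"
      using f_mult f_inv f_nonzero by auto
  qed
  hence f_K: "f k = 1" if "k \<in> ?K" for k
    using that f_Y f_mult subgroup.mem_carrier[OF Y] by (auto simp: set_mult_def)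
  let ?M = "\<lparr>carrier = UNIV, monoid.mult = (*), one = 1 :: complex\<rparr>"
  have "f \<in> hom G ?M" using f_mult by (auto simp: hom_def)
  moreover have "f x = f y" if xy: "x \<in> carrier G" "y \<in> carrier G" "?K #> x = ?K #> y" for x y
  proof -
    have "x \<in> ?K #> y" using rcos_self[OF xy(1) K.subgroup_axioms] xy(3) by simp
    then obtain k where "k \<in> ?K" "x = k \<otimes> y" by (auto simp: r_coset_def)
    thus ?thesis using f_K f_mult xy(2) K.mem_carrier by simp
  qed
  ultimately obtain g where g: "g \<in> hom (G Mod ?K) ?M" "\<And>x. x \<in> carrier G \<Longrightarrow> g (?K #> x) = f x"
    using FactGroup_universal[OF _ quot(1)] by metis
  interpret A: group "G Mod ?K" by (rule K.factorgroup_is_group)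
  define \<chi> where "\<chi> C = (if C \<in> carrier (G Mod ?K) then g C else 0)" for C
  have coset: "?K #> x \<in> carrier (G Mod ?K)" if "x \<in> carrier G" for x using that by (auto simp: carrier_FactGroup)
  have "\<chi> \<one>\<^bsub>G Mod ?K\<^esub> = 1"
    using g(2)[OF one_closed] f_one coset[OF one_closed] coset_join2[OF one_closed K.subgroup_axioms K.one_closed]
    by (simp add: \<chi>_def)
  hence "\<chi> \<in> linear_characters (G Mod ?K)"
    using hom_mult[OF g(1)] A.m_closed by (simp add: linear_characters_def \<chi>_def del: mult_FactGroup one_FactGroup)
  moreover have "\<rho> x = mat 1 1 (\<lambda>_. \<chi> (?K #> x))" if "x \<in> carrier G" for x
    using \<rho>_f[OF that] g(2)[OF that] coset[OF that] by (simp add: \<chi>_def)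
  ultimately show ?thesis using that by (simp add: rel_abelianization_def)
qed

text \<open>The whole group is a subgroup of index one, and a representation of degree one is determined by
  its character of the relative abelianization; a finite abelian group has no more characters
  than elements.\<close>
theorem Rep_1_le_ab_1:
  fixes G (structure)
  assumes G: "group G" and Y: "subgroup Y G"
  shows "Rep 1 G Y \<le> ab 1 G Y"
proof -
  interpret group G by (rule G)
  let ?A = "rel_abelianization G (carrier G) Y"
  let ?I = "irreps 1 G Y"
  let ?E = "equivalent_reps G \<inter> ?I \<times> ?I"
  let ?K = "derived G (carrier G) <#> Y"
  interpret A: comm_group ?A
    by (rule rel_abelianization_quotient[OF G subgroup_self Y subgroup.subset[OF Y]])
  have "rcosets (carrier G) = {carrier G}"
    using coset_join2[OF _ subgroup_self] one_closed by (auto simp: RCOSETS_def)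
  hence "carrier G \<in> intermediate_subgroups G Y 1"
    using subgroup_self subgroup.subset[OF Y] by (simp add: intermediate_subgroups_def ecard_def)
  hence ab: "ecard (carrier ?A) \<le> ab 1 G Y" unfolding ab_def by (rule SUP_upper)
  have "Rep 1 G Y \<le> ecard (carrier ?A)"
  proof (cases "finite (carrier ?A)")
    case True
    have "\<exists>\<chi>\<in>linear_characters ?A. \<forall>x\<in>carrier G. snd a x = mat 1 1 (\<lambda>_. \<chi> (?K #> x))" if "a \<in> ?I" for a
      using linear_character_of_degree_one_rep[OF Y, of "fst a" "snd a"] that by (metis prod.collapse)
    then obtain \<Phi> where \<Phi>: "\<And>a. a \<in> ?I \<Longrightarrow> \<Phi> a \<in> linear_characters ?A"
      "\<And>a x. a \<in> ?I \<Longrightarrow> x \<in> carrier G \<Longrightarrow> snd a x = mat 1 1 (\<lambda>_. \<Phi> a (?K #> x))" by metis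
    have "?E `` {a} = ?E `` {b}" if "a \<in> ?I" "b \<in> ?I" "\<Phi> a = \<Phi> b" for a b
    proof -
      have "fst a = fst b" using that(1,2) by (auto simp: irreps_def irreducible_rep_def)
      moreover have "snd a x = snd b x" if "x \<in> carrier G" for x
        using \<Phi>(2)[OF \<open>a \<in> _\<close> that] \<Phi>(2)[OF \<open>b \<in> _\<close> that] \<open>\<Phi> a = \<Phi> b\<close> by simp
      ultimately have "(a, c) \<in> equivalent_reps G \<longleftrightarrow> (b, c) \<in> equivalent_reps G" for c
        by (simp add: equivalent_reps_def split_beta cong: ball_cong)
      thus ?thesis using that(1,2) by auto
    qed
    then obtain F where F: "\<And>a. a \<in> ?I \<Longrightarrow> ?E `` {a} = F (\<Phi> a)"
      using function_factors_left_gen[of "\<lambda>a. a \<in> ?I" \<Phi> "\<lambda>a. ?E `` {a}"] by metis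
    have "?I // ?E \<subseteq> F ` linear_characters ?A"
      using F \<Phi>(1) by (auto simp: quotient_def)
    moreover have "finite (linear_characters ?A)" "card (linear_characters ?A) = card (carrier ?A)"
      using A.card_linear_characters[OF True] by auto
    ultimately have "finite (?I // ?E)" "card (?I // ?E) \<le> card (carrier ?A)"
      by (auto intro: finite_subset order.trans[OF card_mono] simp: card_image_le dest: surj_card_le)
    thus ?thesis using True by (simp add: Rep_def ecard_def)
  qed (simp add: ecard_def)
  thus ?thesis using ab by (rule order.trans)
qed

theorem proposition37:
  fixes G (structure) and Y :: "'a set"
  assumes "group G" and "subgroup Y G"
  shows "(infinite_sections_visible 1 G Y \<longrightarrow> ab 1 G Y = Rep 1 G Y) \<and>
    (\<forall>n\<ge>1. infinite_sections_visible n G Y \<longrightarrow> ab n G Y \<le> enat n * Rep n G Y)"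
proof (intro conjI impI allI)
  assume "infinite_sections_visible 1 G Y"
  hence "ab 1 G Y \<le> enat 1 * Rep 1 G Y" by (rule ab_le_mult_Rep[OF assms])
  thus "ab 1 G Y = Rep 1 G Y"
    using Rep_1_le_ab_1[OF assms] by (metis mult_1 one_enat_def antisym)
qed (rule ab_le_mult_Rep[OF assms])

end
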